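(* Let $f:\{0,1\}^n\to\{\pm1\}$ be a function, $c\in\mathbb{N}^n$ a cost vector, and $\varepsilon\in(0,\tfrac12)$. There is an efficient $O(\varepsilon)$-error randomized strategy $\mathcal{S}^\diamond$ for $f$ with expected cost $\Delta_c(\mathcal{S}^\diamond)\le\overline{\mathsf{opt}}(f,c,0)\cdot\mathrm{Inf}(f)/\varepsilon$.
   Context: A strategy adaptively queries coordinates of an unknown $x\in\{0,1\}^n$ (possibly using randomness), paying $c_i$ to reveal $x_i$, and outputs $\mathcal{S}(x)\in\{\pm1\}$. $\mathrm{cost}_c(\mathcal{S},x)$ is the total cost paid on $x$; $\Delta_c(\mathcal{S})=\mathbb{E}[\mathrm{cost}_c(\mathcal{S},\mathbf{x})]$ for uniform $\mathbf{x}$ (and internal randomness). $\mathcal{S}$ is an $\varepsilon$-error strategy for $f$ if $\Pr[\mathcal{S}(\mathbf{x})\ne f(\mathbf{x})]\le\varepsilon$. $\overline{\mathsf{opt}}(f,c,\varepsilon)$ is the minimum over $\varepsilon$-error strategies $\mathcal{S}$ for $f$ of the worst-case cost $\max_{x\in\{0,1\}^n}\mathrm{cost}_c(\mathcal{S},x)$; thus $\overline{\mathsf{opt}}(f,c,0)$ is the worst-case cost of the best zero-error strategy. Efficient means each next query and the output are computable in time polynomial in the representation sizes of $f$, $c$, $\varepsilon$. $\mathrm{Inf}(f)=\sum_i\Pr_{\mathbf{x}}[f(\mathbf{x})\ne f(\mathbf{x}^{\oplus i})]$, $\mathbf{x}^{\oplus i}$ being $\mathbf{x}$ with coordinate $i$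 flipped. *)

theory Defs
  imports
    "HOL-Probability.Probability"
    "HOL-Computational_Algebra.Polynomial"
    "HOL-Library.Log_Nat"
begin

definition cube :: "nat \<Rightarrow> bool list set" where
  "cube n = {x. length x = n}"

definition flip_coord :: "bool list \<Rightarrow> nat \<Rightarrow> bool list" where
  "flip_coord x i = x[i := \<not> x ! i]"

definition total_influence :: "nat \<Rightarrow> (bool list \<Rightarrow> int) \<Rightarrow> real" where
  "total_influence n f =
     (\<Sum>i<n. measure_pmf.prob (pmf_of_set (cube n)) {x. f x \<noteq> f (flip_coord x i)})"


section \<open>Query strategies\<close>

text \<open>
  A history lists the coordinates revealed so far, in order, with their values. A randomized
  strategy maps each history to the distribution of its next action, drawn with fresh randomness;
  deterministic strategies are those all of whose distributions are point masses.
\<close>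

datatype action = Query nat | Output int

type_synonym history = "(nat \<times> bool) list"

type_synonym strategy = "history \<Rightarrow> action pmf"

definition is_history :: "nat \<Rightarrow> history \<Rightarrow> bool" where
  "is_history n h \<longleftrightarrow> distinct (map fst h) \<and> fst ` set h \<subseteq> {..<n}"

definition legal_action :: "nat \<Rightarrow> history \<Rightarrow> action \<Rightarrow> bool" where
  "legal_action n h a \<longleftrightarrow>
     (case a of Query i \<Rightarrow> i < n \<and> i \<notin> fst ` set h | Output y \<Rightarrow> y \<in> {-1, 1})"

definition is_strategy :: "nat \<Rightarrow> strategy \<Rightarrow> bool" where
  "is_strategy n S \<longleftrightarrow> (\<forall>h. is_history n h \<longrightarrow> (\<forall>a \<in> set_pmf (S h). legal_action n h a))"

text \<open>
  The first argument bounds the number of actions. A strategy on \<open>n\<close> coordinates performs at most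
  \<open>n\<close> queries and one output, so that the first equation is never reached from \<open>run\<close>.
\<close>

primrec play :: "nat \<Rightarrow> strategy \<Rightarrow> bool list \<Rightarrow> history \<Rightarrow> (history \<times> int) pmf" where
  "play 0 S x h = return_pmf (h, 0)"
| "play (Suc k) S x h =
     bind_pmf (S h) (\<lambda>a. case a of
         Query i \<Rightarrow> play k S x (h @ [(i, x ! i)])
       | Output y \<Rightarrow> return_pmf (h, y))"

definition run :: "nat \<Rightarrow> strategy \<Rightarrow> bool list \<Rightarrow> (history \<times> int) pmf" where
  "run n S x = play (Suc n) S x []"

definition output_pmf :: "nat \<Rightarrow> strategy \<Rightarrow> bool list \<Rightarrow> int pmf" where
  "output_pmf n S x = map_pmf snd (run n S x)"

text \<open>The cost paid on \<open>x\<close> is a random variable; \<open>cost_pmf n c S x\<close> is its distribution.\<close>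

definition cost_pmf :: "nat \<Rightarrow> nat list \<Rightarrow> strategy \<Rightarrow> bool list \<Rightarrow> nat pmf" where
  "cost_pmf n c S x = map_pmf (\<lambda>(h, y). \<Sum>(i, b)\<leftarrow>h. c ! i) (run n S x)"

definition expected_cost :: "nat \<Rightarrow> nat list \<Rightarrow> strategy \<Rightarrow> real" where
  "expected_cost n c S =
     measure_pmf.expectation (bind_pmf (pmf_of_set (cube n)) (cost_pmf n c S)) real"

definition error_prob :: "nat \<Rightarrow> (bool list \<Rightarrow> int) \<Rightarrow> strategy \<Rightarrow> real" where
  "error_prob n f S =
     measure_pmf.prob
       (bind_pmf (pmf_of_set (cube n)) (\<lambda>x. map_pmf (\<lambda>y. (x, y)) (output_pmf n S x)))
       {(x, y). y \<noteq> f x}"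

definition error_strategy :: "nat \<Rightarrow> (bool list \<Rightarrow> int) \<Rightarrow> real \<Rightarrow> strategy \<Rightarrow> bool" where
  "error_strategy n f \<epsilon> S \<longleftrightarrow> is_strategy n S \<and> error_prob n f S \<le> \<epsilon>"

text \<open>The worst case is over the inputs and over the internal randomness.\<close>

definition worst_case_cost :: "nat \<Rightarrow> nat list \<Rightarrow> strategy \<Rightarrow> nat" where
  "worst_case_cost n c S = Max (\<Union>x \<in> cube n. set_pmf (cost_pmf n c S x))"

text \<open>An infimum of natural numbers over a nonempty set, hence a minimum.\<close>

definition opt_worst :: "nat \<Rightarrow> (bool list \<Rightarrow> int) \<Rightarrow> nat list \<Rightarrow> real \<Rightarrow> nat" where
  "opt_worst n f c \<epsilon> = (INF S \<in> {S. error_strategy n f \<epsilon> S}. worst_case_cost n c S)"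


section \<open>A programming language with a running time\<close>

text \<open>
  Jones's WHILE language over binary trees, in variable-free form, with natural numbers at the
  leaves. Every construct takes one step besides its parts. A step allocates at most one cell, and
  addition and truncated subtraction lengthen the longest number by at most one bit; hence a
  computation of \<open>t\<close> steps is simulated by a Turing machine in time polynomial in \<open>t\<close> and in the
  size of the input, and polynomial time has its usual meaning.
\<close>

datatype data = Atom nat | Join data data

fun data_size :: "data \<Rightarrow> nat" where
  "data_size (Atom k) = 1 + floorlog 2 k"
| "data_size (Join u v) = 1 + data_size u + data_size v"

datatype prog =
    Ident
  | Constant nat
  | Left
  | Right
  | Is_Atom
  | Plus
  | Minus
  | Both prog prog
  | Seq prog prog
  | Cond prog prog prog
  | While prog prog

fun left :: "data \<Rightarrow> data" where
  "left (Join u v) = u"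
| "left (Atom k) = Atom 0"

fun right :: "data \<Rightarrow> data" where
  "right (Join u v) = v"
| "right (Atom k) = Atom 0"

fun is_atom :: "data \<Rightarrow> data" where
  "is_atom (Atom k) = Atom 1"
| "is_atom (Join u v) = Atom 0"

fun plus_data :: "data \<Rightarrow> data" where
  "plus_data (Join (Atom j) (Atom k)) = Atom (j + k)"
| "plus_data _ = Atom 0"

fun minus_data :: "data \<Rightarrow> data" where
  "minus_data (Join (Atom j) (Atom k)) = Atom (j - k)"
| "minus_data _ = Atom 0"

text \<open>\<open>exec P u t v\<close>: on input \<open>u\<close>, the program \<open>P\<close> halts after \<open>t\<close> steps with result \<open>v\<close>.\<close>

inductive exec :: "prog \<Rightarrow> data \<Rightarrow> nat \<Rightarrow> data \<Rightarrow> bool" where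
  Ident: "exec Ident u 1 u"
| Constant: "exec (Constant k) u 1 (Atom k)"
| Left: "exec Left u 1 (left u)"
| Right: "exec Right u 1 (right u)"
| Is_Atom: "exec Is_Atom u 1 (is_atom u)"
| Plus: "exec Plus u 1 (plus_data u)"
| Minus: "exec Minus u 1 (minus_data u)"
| Both: "exec P u s v \<Longrightarrow> exec Q u t w \<Longrightarrow> exec (Both P Q) u (s + t + 1) (Join v w)"
| Seq: "exec P u s v \<Longrightarrow> exec Q v t w \<Longrightarrow> exec (Seq P Q) u (s + t + 1) w"
| Cond_True: "exec B u s b \<Longrightarrow> b \<noteq> Atom 0 \<Longrightarrow> exec P u t v \<Longrightarrow> exec (Cond B P Q) u (s + t + 1) v"
| Cond_False: "exec B u s (Atom 0) \<Longrightarrow> exec Q u t v \<Longrightarrow> exec (Cond B P Q) u (s + t + 1) v"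
| While_True: "exec B u s b \<Longrightarrow> b \<noteq> Atom 0 \<Longrightarrow> exec P u t v \<Longrightarrow> exec (While B P) v r w
    \<Longrightarrow> exec (While B P) u (s + t + r + 1) w"
| While_False: "exec B u s (Atom 0) \<Longrightarrow> exec (While B P) u (s + 1) u"

lemma exec_det: "exec P u s v \<Longrightarrow> exec P u t w \<Longrightarrow> s = t \<and> v = w"
proof (induction arbitrary: t w rule: exec.induct)
  case (While_True B u s b P t' v r w')
  from While_True.prems show ?case
    by (cases) (use While_True in \<open>metis\<close>)+
next
  case (While_False B u s P)
  from While_False.prems show ?case by cases (use While_False in \<open>metis\<close>)+
next
  case (Cond_True B u s b P t' v Q)
  from Cond_True.prems show ?case by cases (use Cond_True in \<open>metis\<close>)+
next
  case (Cond_False B u s Q t' v P)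
  from Cond_False.prems show ?case by cases (use Cond_False in \<open>metis\<close>)+
next
  case (Both P u s v Q t' w')
  from Both.prems show ?case by cases (use Both in \<open>metis\<close>)
next
  case (Seq P u s v Q t' w')
  from Seq.prems show ?case by cases (use Seq in \<open>metis\<close>)
qed (auto elim: exec.cases)

definition halts_within :: "prog \<Rightarrow> data \<Rightarrow> nat \<Rightarrow> data \<Rightarrow> bool" where
  "halts_within P u T v \<longleftrightarrow> (\<exists>t \<le> T. exec P u t v)"

definition enc_list :: "('a \<Rightarrow> data) \<Rightarrow> 'a list \<Rightarrow> data" where
  "enc_list e xs = foldr (\<lambda>x. Join (e x)) xs (Atom 0)"

definition enc_bool :: "bool \<Rightarrow> data" where
  "enc_bool b = Atom (of_bool b)"

definition enc_sign :: "int \<Rightarrow> data" where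
  "enc_sign y = Atom (if y = 1 then 1 else 0)"

definition enc_bits :: "bool list \<Rightarrow> data" where
  "enc_bits = enc_list enc_bool"

definition enc_history :: "history \<Rightarrow> data" where
  "enc_history = enc_list (\<lambda>(i, b). Join (Atom i) (enc_bool b))"

fun enc_action :: "action \<Rightarrow> data" where
  "enc_action (Query i) = Join (Atom 0) (Atom i)"
| "enc_action (Output y) = Join (Atom 1) (enc_sign y)"


section \<open>Efficient strategies\<close>

text \<open>
  \<open>R n w f\<close> reads: \<open>w\<close> represents \<open>f\<close>, a function on \<open>n\<close> bits. The only thing asked of a way of
  representing functions (circuits, formulas, decision trees, truth tables, ...) is that a
  represented function can be evaluated in polynomial time.
\<close>

type_synonym scheme = "nat \<Rightarrow> data \<Rightarrow> (bool list \<Rightarrow> int) \<Rightarrow> bool"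

definition representation_scheme :: "scheme \<Rightarrow> bool" where
  "representation_scheme R \<longleftrightarrow>
     (\<forall>n w f. R n w f \<longrightarrow> f \<in> cube n \<rightarrow> {-1, 1}) \<and>
     (\<exists>P (p :: nat poly). \<forall>n w f. R n w f \<longrightarrow> (\<forall>x \<in> cube n.
        halts_within P (Join w (enc_bits x)) (poly p (data_size w + n)) (enc_sign (f x))))"

text \<open>
  Costs are written in binary. The error parameter is given as \<open>\<lceil>1 / \<epsilon>\<rceil>\<close> in unary, which determines
  \<open>\<epsilon>\<close> up to a constant factor; thus \<open>1 / \<epsilon>\<close> counts towards the size of the instance. With
  \<open>\<epsilon>\<close> in binary one would have to detect events of exponentially small probability, e.g. to
  decide whether a circuit is satisfiable.
\<close>

definition enc_instance :: "data \<Rightarrow> nat list \<Rightarrow> real \<Rightarrow> data" where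
  "enc_instance w c \<epsilon> =
     Join w (Join (enc_list Atom c) (enc_list Atom (replicate (nat \<lceil>1 / \<epsilon>\<rceil>) 0)))"

text \<open>
  \<open>S w c \<epsilon>\<close> is the strategy for the instance \<open>(w, c, \<epsilon>)\<close>. The family is efficient if a single
  program, given the instance, the history and polynomially many uniform random bits, computes the
  next action in polynomial time.
\<close>

definition efficient :: "scheme \<Rightarrow> (data \<Rightarrow> nat list \<Rightarrow> real \<Rightarrow> strategy) \<Rightarrow> bool" where
  "efficient R S \<longleftrightarrow>
     (\<exists>P (p :: nat poly) (q :: nat poly). \<forall>n w f c \<epsilon> h.
        R n w f \<and> length c = n \<and> 0 < \<epsilon> \<and> \<epsilon> < 1 / 2 \<and> is_history n h \<longrightarrow>
        (let I = enc_instance w c \<epsilon>; N = data_size I in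
         \<exists>act. (\<forall>r \<in> cube (poly q N).
                  halts_within P (Join I (Join (enc_history h) (enc_bits r))) (poly p N)
                    (enc_action (act r))) \<and>
               S w c \<epsilon> h = map_pmf act (pmf_of_set (cube (poly q N)))))"


section \<open>Truth tables\<close>

text \<open>Truth tables form a representation scheme, and every function has one.\<close>

fun table_lookup :: "data \<Rightarrow> bool list \<Rightarrow> data" where
  "table_lookup w [] = w"
| "table_lookup w (b # x) = table_lookup (if b then right w else left w) x"

definition truth_table :: scheme where
  "truth_table n w f \<longleftrightarrow>
     f \<in> cube n \<rightarrow> {-1, 1} \<and> (\<forall>x \<in> cube n. table_lookup w x = enc_sign (f x))"

definition lookup_prog :: prog where
  "lookup_prog =
     Seq (While (Cond (Seq Right Is_Atom) (Constant 0) (Constant 1))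
            (Both (Cond (Seq Right Left) (Seq Left Right) (Seq Left Left)) (Seq Right Right)))
         Left"

lemma lookup_loop:
  "exec (While (Cond (Seq Right Is_Atom) (Constant 0) (Constant 1))
            (Both (Cond (Seq Right Left) (Seq Left Right) (Seq Left Left)) (Seq Right Right)))
     (Join w (enc_bits x)) (17 * length x + 6) (Join (table_lookup w x) (Atom 0))"
proof (induction x arbitrary: w)
  case Nil
  have "exec (Seq Right Is_Atom) (Join w (Atom 0)) (1 + 1 + 1) (Atom 1)"
    using exec.Seq[OF exec.Right exec.Is_Atom, of "Join w (Atom 0)"] by (simp add: numeral_eq_Suc)
  from exec.Cond_True[OF this _ exec.Constant]
  have "exec (Cond (Seq Right Is_Atom) (Constant 0) (Constant 1)) (Join w (Atom 0)) 5 (Atom 0)"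
    by (simp add: numeral_eq_Suc)
  from exec.While_False[OF this] show ?case by (simp add: enc_bits_def enc_list_def)
next
  case (Cons b x)
  let ?u = "Join w (Join (enc_bool b) (enc_bits x))"
  have "exec (Seq Right Is_Atom) ?u (1 + 1 + 1) (Atom 0)"
    using exec.Seq[OF exec.Right exec.Is_Atom, of ?u] by (simp add: numeral_eq_Suc)
  from exec.Cond_False[OF this exec.Constant]
  have B: "exec (Cond (Seq Right Is_Atom) (Constant 0) (Constant 1)) ?u 5 (Atom 1)"
    by (simp add: numeral_eq_Suc)
  have 1: "exec (Seq Right Left) ?u 3 (enc_bool b)"
    using exec.Seq[OF exec.Right exec.Left, of ?u] by (simp add: numeral_eq_Suc)
  have 2: "exec (Seq Left Right) ?u 3 (right w)" "exec (Seq Left Left) ?u 3 (left w)"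
    "exec (Seq Right Right) ?u 3 (enc_bits x)"
    using exec.Seq[OF exec.Left exec.Right, of ?u] exec.Seq[OF exec.Left exec.Left, of ?u]
      exec.Seq[OF exec.Right exec.Right, of ?u] by (simp_all add: numeral_eq_Suc)
  let ?w = "if b then right w else left w"
  have "exec (Cond (Seq Right Left) (Seq Left Right) (Seq Left Left)) ?u 7 ?w"
    using exec.Cond_True[OF 1 _ 2(1), of "Seq Left Left"] exec.Cond_False[OF _ 2(2), of "Seq Right Left" 3 "Seq Left Right"] 1
    by (cases b) (simp_all add: enc_bool_def numeral_eq_Suc)
  from exec.Both[OF this 2(3)]
  have P: "exec (Both (Cond (Seq Right Left) (Seq Left Right) (Seq Left Left)) (Seq Right Right))
    ?u 11 (Join ?w (enc_bits x))" by (simp add: numeral_eq_Suc)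
  from exec.While_True[OF B _ P Cons.IH[of ?w]]
  show ?case by (simp add: enc_bits_def enc_list_def add_ac)
qed

lemma truth_table_scheme: "representation_scheme truth_table"
proof -
  have "halts_within lookup_prog (Join w (enc_bits x)) (poly [:8, 17:] (data_size w + n)) (enc_sign (f x))"
    if "truth_table n w f" "x \<in> cube n" for n w f x
  proof -
    have "exec lookup_prog (Join w (enc_bits x)) (17 * length x + 6 + 1 + 1) (enc_sign (f x))"
      using exec.Seq[OF lookup_loop exec.Left, of w x] that
      by (simp add: lookup_prog_def truth_table_def)
    then show ?thesis using that unfolding halts_within_def by (intro exI[of _ "17 * length x + 6 + 1 + 1"]) (auto simp: cube_def)
  qed
  moreover have "\<forall>n w f. truth_table n w f \<longrightarrow> f \<in> cube n \<rightarrow> {-1, 1}"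
    by (simp add: truth_table_def)
  ultimately show ?thesis unfolding representation_scheme_def by blast
qed

lemma truth_table_exists:
  "f \<in> cube n \<rightarrow> {-1, 1} \<Longrightarrow> \<exists>w. truth_table n w f"
proof -
  have "\<exists>w. \<forall>x \<in> cube n. table_lookup w x = g x" for g :: "bool list \<Rightarrow> data"
  proof (induction n arbitrary: g)
    case 0 then show ?case by (auto simp: cube_def)
  next
    case (Suc n)
    obtain u v where "\<forall>x \<in> cube n. table_lookup u x = g (False # x)"
      "\<forall>x \<in> cube n. table_lookup v x = g (True # x)" using Suc.IH[of "\<lambda>x. g (False # x)"] Suc.IH[of "\<lambda>x. g (True # x)"] by blast
    then have "\<forall>x \<in> cube (Suc n). table_lookup (Join u v) x = g x"
      by (auto simp: cube_def length_Suc_conv)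
    then show ?case by blast
  qed
  then show "f \<in> cube n \<rightarrow> {-1, 1} \<Longrightarrow> \<exists>w. truth_table n w f"
    by (auto simp: truth_table_def)
qed

end

theory Submission
  imports Defs
begin

text \<open>
  At a history \<open>h\<close>, sample polynomially many points consistent with \<open>h\<close>. If the restriction \<open>f\<^sub>h\<close> looks nearly
  constant, output its majority value; otherwise query the coordinate maximising the estimated
  ratio of influence to cost. Write \<open>Var\<close> for the variance of \<open>f\<^sub>h\<close>. The OSSS inequality applied to an optimal
  zero-error decision tree yields a coordinate with \<open>Inf\<^sub>i(f\<^sub>h) / c\<^sub>i \<ge> Var / opt\<close>, and discarding influences below
  \<open>Var / 2n\<close> shows that one such coordinate, up to a constant, is visible to sampling. Querying \<open>i\<close>
  lowers the expected total influence by exactly \<open>Inf\<^sub>i(f\<^sub>h)\<close>, so cost \<open>c\<close> is paid for by a drop of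
  order \<open>c \<epsilon> / opt\<close>.

  No constant may be lost in the cost bound, so misleading samples must be paid for as well. Two
  facts make this possible with only polynomially small failure probabilities: a queried
  coordinate has been seen to be relevant, and a relevant coordinate costs at most \<open>opt\<close>; and
  stopping releases the whole remaining influence, which is at least the variance.
\<close>

section \<open>Averages over the cube and influences\<close>

text \<open>The constant 1 in the cost bound survives sampling because a factor 2 is held in
  reserve. On good samples a query is made only while the variance is at least 6/k, hence at least
  4\<epsilon>, and the chosen coordinate then satisfies 2\<epsilon> c_i \<le> opt Inf_i. This uses
  half of opt/\<epsilon>; the other half pays for bad samples, since \<epsilon> < 1/2 gives opt
  \<le> opt/(2\<epsilon>).

  The obstacle is a restriction that is almost constant. Its remaining influence can be
  exponentially small, so no fixed failure probability within reach of polynomially many samples is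
  covered by it. The remedy is to keep the factor p(1-p) in the Chebyshev bound for the mean: the
  chance of querying there is at most p(1-p), and the influence released by stopping is at least
  4p(1-p).

  One number opt serves at every history. A zero-error strategy is right for every outcome of its
  coins, so the coins can be fixed; pruning the resulting tree by a history yields a tree for the
  restriction that costs no more.\<close>

definition avg :: "nat \<Rightarrow> (bool list \<Rightarrow> real) \<Rightarrow> real" where
  "avg n \<phi> = (\<Sum>x\<in>cube n. \<phi> x) / 2 ^ n"

text \<open>Setting coordinate \<open>i\<close> both ways, instead of flipping it, reduces the
  effect of restrictions on influences to commuting list updates.\<close>

definition infl :: "nat \<Rightarrow> (bool list \<Rightarrow> 'a) \<Rightarrow> nat \<Rightarrow> real" where
  "infl n g i = avg n (\<lambda>x. of_bool (g (x[i := True]) \<noteq> g (x[i := False])))"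

lemma finite_cube [simp]: "finite (cube n)"
  using finite_lists_length_eq[of "UNIV :: bool set" n] by (simp add: cube_def)

lemma card_cube [simp]: "card (cube n) = 2 ^ n"
  using card_lists_length_eq[of "UNIV :: bool set" n] by (simp add: cube_def)

lemma cube_nonempty [simp]: "cube n \<noteq> {}"
proof -
  have "replicate n True \<in> cube n" by (simp add: cube_def)
  then show ?thesis by blast
qed

lemma cube_update [simp]: "x \<in> cube n \<Longrightarrow> x[i := b] \<in> cube n"
  by (simp add: cube_def)

lemma avg_cong: "(\<And>x. x \<in> cube n \<Longrightarrow> \<phi> x = \<psi> x) \<Longrightarrow> avg n \<phi> = avg n \<psi>"
  unfolding avg_def by (metis (mono_tags, lifting) sum.cong)

lemma avg_mono: "(\<And>x. x \<in> cube n \<Longrightarrow> \<phi> x \<le> \<psi> x) \<Longrightarrow> avg n \<phi> \<le> avg n \<psi>"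
  unfolding avg_def by (intro divide_right_mono sum_mono) auto

lemma avg_const [simp]: "avg n (\<lambda>x. a) = a"
  by (simp add: avg_def)

lemma avg_add: "avg n (\<lambda>x. \<phi> x + \<psi> x) = avg n \<phi> + avg n \<psi>"
  by (simp add: avg_def sum.distrib add_divide_distrib)

lemma avg_diff: "avg n (\<lambda>x. \<phi> x - \<psi> x) = avg n \<phi> - avg n \<psi>"
  by (simp add: avg_def sum_subtractf diff_divide_distrib)

lemma avg_mult: "avg n (\<lambda>x. a * \<phi> x) = a * avg n \<phi>"
  by (simp add: avg_def sum_distrib_left)

lemma avg_mult_right: "avg n (\<lambda>x. \<phi> x * a) = avg n \<phi> * a"
  using avg_mult[of n a \<phi>] by (simp add: mult.commute)

lemma avg_divide: "avg n (\<lambda>x. \<phi> x / a) = avg n \<phi> / a"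
  using avg_mult_right[of n \<phi> "inverse a"] by (simp add: field_simps)

lemma avg_sum: "avg n (\<lambda>x. \<Sum>i\<in>I. \<phi> i x) = (\<Sum>i\<in>I. avg n (\<phi> i))"
  by (simp add: avg_def sum.swap[of _ "cube n"] sum_divide_distrib)

lemma avg_abs: "\<bar>avg n \<phi>\<bar> \<le> avg n (\<lambda>x. \<bar>\<phi> x\<bar>)"
  by (simp add: avg_def divide_right_mono)

lemma avg_nonneg: "(\<And>x. x \<in> cube n \<Longrightarrow> 0 \<le> \<phi> x) \<Longrightarrow> 0 \<le> avg n \<phi>"
  using avg_mono[of n "\<lambda>x. 0" \<phi>] by simp

lemma avg_le_const: "(\<And>x. x \<in> cube n \<Longrightarrow> \<phi> x \<le> a) \<Longrightarrow> avg n \<phi> \<le> a"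
  using avg_mono[of n \<phi> "\<lambda>x. a"] by simp

lemma avg_swap: "avg n (\<lambda>x. avg m (\<lambda>y. \<phi> x y)) = avg m (\<lambda>y. avg n (\<lambda>x. \<phi> x y))"
  by (simp add: avg_def sum_divide_distrib[symmetric] sum.swap[of _ "cube n" "cube m"] mult.commute)

lemma avg_append: "avg (a + b) \<phi> = avg a (\<lambda>x. avg b (\<lambda>y. \<phi> (x @ y)))"
proof -
  have "(\<Sum>z\<in>cube (a + b). \<phi> z) = (\<Sum>(x, y)\<in>cube a \<times> cube b. \<phi> (x @ y))"
    by (rule sum.reindex_bij_witness[where i = "\<lambda>(x, y). x @ y" and j = "\<lambda>z. (take a z, drop a z)"])
       (auto simp: cube_def)
  then show ?thesis
    by (simp add: avg_def sum.cartesian_product[symmetric] sum_divide_distrib[symmetric] power_add mult.commute)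
qed

text \<open>Flipping coordinate \<open>i\<close> is an involution of the cube, so
  \<open>\<phi>\<close> may be averaged over \<open>x\<close> and its flip, which are the two
  updates of \<open>x\<close> at \<open>i\<close>.\<close>

lemma avg_split:
  assumes "i < n"
  shows "avg n \<phi> = (avg n (\<lambda>x. \<phi> (x[i := True])) + avg n (\<lambda>x. \<phi> (x[i := False]))) / 2"
proof -
  have "(\<Sum>x\<in>cube n. \<phi> x) = (\<Sum>x\<in>cube n. \<phi> (flip_coord x i))"
    by (rule sum.reindex_bij_witness[where i = "\<lambda>x. flip_coord x i" and j = "\<lambda>x. flip_coord x i"])
       (use assms in \<open>auto simp: flip_coord_def cube_def\<close>)
  then have "avg n \<phi> = avg n (\<lambda>x. \<phi> (flip_coord x i))"
    by (simp add: avg_def)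
  then have "2 * avg n \<phi> = avg n (\<lambda>x. \<phi> x + \<phi> (flip_coord x i))"
    by (simp add: avg_add)
  also have "\<dots> = avg n (\<lambda>x. \<phi> (x[i := True]) + \<phi> (x[i := False]))"
  proof (rule avg_cong)
    fix x assume "x \<in> cube n"
    then have "x[i := x ! i] = x" by simp
    then show "\<phi> x + \<phi> (flip_coord x i) = \<phi> (x[i := True]) + \<phi> (x[i := False])"
      by (cases "x ! i") (auto simp: flip_coord_def)
  qed
  finally show ?thesis by (simp add: avg_add)
qed

section \<open>Influences and how a query changes them\<close>

lemma total_influence_eq: "total_influence n f = (\<Sum>i<n. infl n f i)"
proof -
  have "measure_pmf.prob (pmf_of_set (cube n)) {x. f x \<noteq> f (flip_coord x i)} = infl n f i" for i
  proof -
    have "measure_pmf.prob (pmf_of_set (cube n)) {x. f x \<noteq> f (flip_coord x i)}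
        = avg n (\<lambda>x. of_bool (f x \<noteq> f (flip_coord x i)))"
      by (simp add: measure_pmf_of_set avg_def of_bool_def sum.If_cases Int_def)
    also have "\<dots> = infl n f i"
      unfolding infl_def
    proof (rule avg_cong)
      fix x assume "x \<in> cube n"
      have "x[i := x ! i] = x" by simp
      then show "of_bool (f x \<noteq> f (flip_coord x i)) = of_bool (f (x[i := True]) \<noteq> f (x[i := False]))"
        by (cases "x ! i") (auto simp: flip_coord_def)
    qed
    finally show ?thesis .
  qed
  then show ?thesis by (simp add: total_influence_def)
qed

lemma infl_nonneg: "0 \<le> infl n g i"
  by (simp add: infl_def avg_nonneg)

text \<open>For \<open>j \<noteq> i\<close> the two restrictions split the event that
  \<open>j\<close> is sensitive according to the value of coordinate \<open>i\<close>; for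
  \<open>j = i\<close> both restrictions ignore \<open>i\<close>.\<close>

lemma infl_restrict:
  assumes "i < n" "j < n"
  shows "(infl n (\<lambda>x. g (x[i := True])) j + infl n (\<lambda>x. g (x[i := False])) j) / 2
       = (if j = i then 0 else infl n g j)"
proof (cases "j = i")
  case True
  then show ?thesis by (simp add: infl_def)
next
  case False
  then show ?thesis
    using avg_split[OF assms(1), of "\<lambda>x. of_bool (g (x[j := True]) \<noteq> g (x[j := False]))"]
    by (simp add: infl_def list_update_swap)
qed

lemma sum_infl_restrict:
  assumes "i < n"
  shows "((\<Sum>j<n. infl n (\<lambda>x. g (x[i := True])) j) + (\<Sum>j<n. infl n (\<lambda>x. g (x[i := False])) j)) / 2
       = (\<Sum>j<n. infl n g j) - infl n g i"
proof -
  have "((\<Sum>j<n. infl n (\<lambda>x. g (x[i := True])) j) + (\<Sum>j<n. infl n (\<lambda>x. g (x[i := False])) j)) / 2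
      = (\<Sum>j<n. if j = i then 0 else infl n g j)"
    by (simp add: sum.distrib[symmetric] sum_divide_distrib infl_restrict[OF assms])
  also have "\<dots> = (\<Sum>j<n. infl n g j) - infl n g i"
    using assms by (simp add: sum.remove[of "{..<n}" i] cong: if_cong)
  finally show ?thesis .
qed


section \<open>Decision trees and the OSSS inequality\<close>

datatype tree = Leaf int | Node nat tree tree

primrec tree_eval :: "tree \<Rightarrow> bool list \<Rightarrow> int" where
  "tree_eval (Leaf y) x = y"
| "tree_eval (Node i l r) x = (if x ! i then tree_eval r x else tree_eval l x)"

primrec tree_vars :: "tree \<Rightarrow> nat set" where
  "tree_vars (Leaf y) = {}"
| "tree_vars (Node i l r) = insert i (tree_vars l \<union> tree_vars r)"

text \<open>The bound on leaves is included because the covariance estimate uses that the tree is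
  bounded by 1; it also admits the default leaf 0 of \<open>strategy_tree\<close>.\<close>

primrec read_once :: "tree \<Rightarrow> bool" where
  "read_once (Leaf y) \<longleftrightarrow> \<bar>y\<bar> \<le> 1"
| "read_once (Node i l r) \<longleftrightarrow> i \<notin> tree_vars l \<union> tree_vars r \<and> read_once l \<and> read_once r"

primrec tree_cost :: "nat list \<Rightarrow> tree \<Rightarrow> nat" where
  "tree_cost c (Leaf y) = 0"
| "tree_cost c (Node i l r) = c ! i + max (tree_cost c l) (tree_cost c r)"

primrec path_cost :: "nat list \<Rightarrow> tree \<Rightarrow> bool list \<Rightarrow> nat" where
  "path_cost c (Leaf y) x = 0"
| "path_cost c (Node i l r) x = c ! i + (if x ! i then path_cost c r x else path_cost c l x)"

text \<open>For a read-once tree this is the expected sum of \<open>a\<close> over the coordinates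
  queried on a uniform input. With \<open>a\<close> the influences it is the right-hand side of the
  OSSS inequality.\<close>

primrec path_avg :: "(nat \<Rightarrow> real) \<Rightarrow> tree \<Rightarrow> real" where
  "path_avg a (Leaf y) = 0"
| "path_avg a (Node i l r) = a i + (path_avg a l + path_avg a r) / 2"

lemma tree_eval_update [simp]: "i \<notin> tree_vars t \<Longrightarrow> tree_eval t (x[i := b]) = tree_eval t x"
  by (induction t) auto

lemma path_cost_update [simp]: "i \<notin> tree_vars t \<Longrightarrow> path_cost c t (x[i := b]) = path_cost c t x"
  by (induction t) auto

lemma abs_tree_eval_le: "read_once t \<Longrightarrow> \<bar>tree_eval t x\<bar> \<le> 1"
  by (induction t) simp_all

text \<open>In a read-once tree every path is realisable: fixing the root's coordinate does not
  disturb the input found for the subtree.\<close>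

lemma tree_cost_attained:
  assumes "read_once t" "tree_vars t \<subseteq> {..<n}"
  shows "\<exists>x\<in>cube n. path_cost c t x = tree_cost c t"
  using assms
proof (induction t)
  case (Leaf y)
  have "replicate n True \<in> cube n" by (simp add: cube_def)
  then show ?case by (intro bexI) simp_all
next
  case (Node i l r)
  then obtain x y where xy: "x \<in> cube n" "path_cost c l x = tree_cost c l"
    "y \<in> cube n" "path_cost c r y = tree_cost c r" by auto
  have "i < n" using Node.prems by simp
  show ?case
  proof (cases "tree_cost c l \<le> tree_cost c r")
    case True
    then show ?thesis
      using Node.prems xy \<open>i < n\<close> by (intro bexI[of _ "y[i := True]"]) (auto simp: cube_def)
  next
    case False
    then show ?thesis
      using Node.prems xy \<open>i < n\<close> by (intro bexI[of _ "x[i := False]"]) (auto simp: cube_def)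
  qed
qed

text \<open>The two inputs differ only at \<open>i\<close>, so they follow the same path until
  \<open>i\<close> is queried; different answers force such a query.\<close>

lemma relevant_cost_le:
  "tree_eval t (x[i := True]) \<noteq> tree_eval t (x[i := False]) \<Longrightarrow> c ! i \<le> tree_cost c t"
proof (induction t)
  case (Node j l r)
  show ?case
  proof (cases "j = i")
    case False
    then have "x[i := True] ! j = x ! j" "x[i := False] ! j = x ! j" by simp_all
    then show ?thesis using Node by (cases "x ! j") (simp_all add: trans_le_add2 max.coboundedI1 max.coboundedI2)
  qed simp
qed simp

text \<open>Comparing both subtrees with the whole of \<open>g\<close>, rather than with its restrictions, makes the
  induction go through; replacing \<open>g\<close> by its restriction costs one influence per node.\<close>

lemma tree_covariance:
  fixes g :: "bool list \<Rightarrow> real"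
  assumes "read_once t" "tree_vars t \<subseteq> {..<n}"
  shows "\<bar>avg n (\<lambda>x. tree_eval t x * g x) - avg n (tree_eval t) * avg n g\<bar>
       \<le> path_avg (\<lambda>i. avg n (\<lambda>x. \<bar>g (x[i := True]) - g (x[i := False])\<bar>) / 2) t"
    (is "_ \<le> path_avg ?J t")
  using assms
proof (induction t)
  case (Leaf y)
  then show ?case by (simp add: avg_mult)
next
  case (Node i l r)
  have i: "i < n" and il: "i \<notin> tree_vars l" and ir: "i \<notin> tree_vars r"
    using Node.prems by auto
  have T: "avg n (tree_eval (Node i l r)) = (avg n (tree_eval r) + avg n (tree_eval l)) / 2"
    using i il ir by (subst avg_split[OF i]) (intro arg_cong2[of _ _ _ _ "\<lambda>a b. (a + b) / 2"] avg_cong, auto simp: cube_def)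
  have Tg: "avg n (\<lambda>x. tree_eval (Node i l r) x * g x)
      = (avg n (\<lambda>x. tree_eval r x * g (x[i := True])) + avg n (\<lambda>x. tree_eval l x * g (x[i := False]))) / 2"
    using i il ir by (subst avg_split[OF i]) (intro arg_cong2[of _ _ _ _ "\<lambda>a b. (a + b) / 2"] avg_cong, auto simp: cube_def)
  have shift: "\<bar>avg n (\<lambda>x. tree_eval t x * g (x[i := b])) - avg n (\<lambda>x. tree_eval t x * g x)\<bar> \<le> ?J i"
    if "read_once t" for t b
  proof -
    have "avg n (\<lambda>x. tree_eval t x * g (x[i := b])) - avg n (\<lambda>x. tree_eval t x * g x)
        = avg n (\<lambda>x. tree_eval t x * (g (x[i := b]) - g x))"
      by (simp add: avg_diff right_diff_distrib)
    then have "\<bar>avg n (\<lambda>x. tree_eval t x * g (x[i := b])) - avg n (\<lambda>x. tree_eval t x * g x)\<bar>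
        \<le> avg n (\<lambda>x. \<bar>tree_eval t x * (g (x[i := b]) - g x)\<bar>)"
      using avg_abs[of n "\<lambda>x. tree_eval t x * (g (x[i := b]) - g x)"] by (simp only:)
    also have "\<dots> \<le> avg n (\<lambda>x. \<bar>g (x[i := b]) - g x\<bar>)"
    proof (rule avg_mono)
      fix x
      have "\<bar>real_of_int (tree_eval t x)\<bar> \<le> 1"
        using abs_tree_eval_le[OF that, of x] by linarith
      then show "\<bar>tree_eval t x * (g (x[i := b]) - g x)\<bar> \<le> \<bar>g (x[i := b]) - g x\<bar>"
        by (simp add: abs_mult mult_left_le_one_le)
    qed
    \<comment> \<open>Half of the inputs already have value \<open>b\<close> at \<open>i\<close> and
      contribute nothing; hence the factor 1/2 in \<open>?J\<close>.\<close>
    also have "\<dots> = ?J i"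
      by (subst avg_split[OF i], cases b) (simp_all add: abs_minus_commute)
    finally show ?thesis .
  qed
  show ?case
    using Node shift[of l False] shift[of r True]
    unfolding T Tg by (simp add: field_simps) argo
qed

text \<open>Along a path the costs add up to at most the tree cost, and \<open>\<tau>\<close> is
  charged at most \<open>card V\<close> times because no coordinate repeats. The slack
  \<open>\<tau>\<close> is what later allows small influences to be ignored.\<close>

lemma path_avg_le:
  assumes "\<And>i. i \<in> tree_vars t \<Longrightarrow> a i \<le> \<mu> * real (c ! i) + \<tau>" "read_once t"
    "finite V" "tree_vars t \<subseteq> V" "0 \<le> \<mu>" "0 \<le> \<tau>"
  shows "path_avg a t \<le> \<mu> * tree_cost c t + \<tau> * card V"
  using assms
proof (induction t arbitrary: V)
  case (Node i l r)
  define N where "N = card (V - {i})"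
  have V: "card V = Suc N"
    unfolding N_def using Node.prems by (intro card_Suc_Diff1[symmetric]) auto
  have 1: "path_avg a l \<le> \<mu> * tree_cost c l + \<tau> * N"
    "path_avg a r \<le> \<mu> * tree_cost c r + \<tau> * N"
    unfolding N_def using Node.prems by (intro Node.IH; auto)+
  define M where "M = max (tree_cost c l) (tree_cost c r)"
  have 2: "\<mu> * tree_cost c l \<le> \<mu> * M" "\<mu> * tree_cost c r \<le> \<mu> * M"
    using Node.prems by (simp_all add: M_def mult_left_mono)
  have midpoint: "(u + v) / 2 \<le> w" if "u \<le> w" "v \<le> w" for u v w :: real
    using that by simp
  have "a i \<le> \<mu> * real (c ! i) + \<tau>"
    using Node.prems by simp
  moreover have "path_avg a l \<le> \<mu> * M + \<tau> * N" "path_avg a r \<le> \<mu> * M + \<tau> * N"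
    using order_trans[OF 1(1) add_right_mono[OF 2(1)]] order_trans[OF 1(2) add_right_mono[OF 2(2)]] by simp_all
  ultimately have "path_avg a (Node i l r) \<le> (\<mu> * real (c ! i) + \<tau>) + (\<mu> * M + \<tau> * N)"
    unfolding path_avg.simps by (intro add_mono midpoint)
  then show ?case
    by (simp add: V M_def distrib_left)
qed simp

text \<open>Each coordinate is queried with probability at most 1. Applied to influences, this
  weakens OSSS to the Poincare inequality.\<close>

lemma path_avg_le_sum:
  assumes "\<And>i. 0 \<le> a i" "read_once t" "finite V" "tree_vars t \<subseteq> V"
  shows "path_avg a t \<le> sum a V"
  using assms(2-)
proof (induction t arbitrary: V)
  case (Leaf y)
  then show ?case using assms(1) by (simp add: sum_nonneg)
next
  case (Node i l r)
  have "path_avg a l \<le> sum a (V - {i})" "path_avg a r \<le> sum a (V - {i})"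
    using Node.prems by (intro Node.IH; auto)+
  moreover have "sum a V = a i + sum a (V - {i})"
    using Node.prems by (intro sum.remove) auto
  ultimately show ?case by simp
qed

text \<open>When the tree computes \<open>g\<close>, its covariance with \<open>g\<close> is the
  variance 1 - (2p - 1)^2; and for values 1 and -1 half the mean jump at \<open>i\<close> is the
  influence of \<open>i\<close>.\<close>

lemma variance_le_path_avg:
  assumes t: "read_once t" "tree_vars t \<subseteq> {..<n}" "\<And>x. x \<in> cube n \<Longrightarrow> tree_eval t x = g x"
    and g: "g \<in> cube n \<rightarrow> {-1, 1}"
  defines "p \<equiv> avg n (\<lambda>x. of_bool (g x = 1))"
  shows "4 * (p * (1 - p)) \<le> path_avg (infl n g) t"
proof -
  have "avg n g = avg n (\<lambda>x. 2 * of_bool (g x = 1) - 1)"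
    using g by (intro avg_cong) (auto simp: Pi_def)
  then have mean: "avg n g = 2 * p - 1"
    by (simp add: p_def avg_diff avg_mult)
  have "avg n (tree_eval t) = avg n g"
    using t by (intro avg_cong) simp
  moreover have "avg n (\<lambda>x. tree_eval t x * real_of_int (g x)) = avg n (\<lambda>x. 1)"
    using t g by (intro avg_cong) (auto simp: Pi_def)
  ultimately have "4 * (p * (1 - p))
      = avg n (\<lambda>x. tree_eval t x * real_of_int (g x)) - avg n (tree_eval t) * avg n g"
    by (simp only: mean) (simp add: algebra_simps)
  also have "\<dots> \<le> path_avg (\<lambda>i. avg n (\<lambda>x. \<bar>real_of_int (g (x[i := True])) - g (x[i := False])\<bar>) / 2) t"
    using tree_covariance[OF t(1,2), of "\<lambda>x. g x"] by linarith
  also have "(\<lambda>i. avg n (\<lambda>x. \<bar>real_of_int (g (x[i := True])) - g (x[i := False])\<bar>) / 2) = infl n g"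
    unfolding infl_def avg_divide[symmetric]
  proof (intro ext avg_cong)
    fix i x assume "x \<in> cube n"
    then have "g (x[i := b]) \<in> {-1, 1}" for b using g by auto
    from this[of True] this[of False]
    show "\<bar>real_of_int (g (x[i := True])) - real_of_int (g (x[i := False]))\<bar> / 2
      = of_bool (g (x[i := True]) \<noteq> g (x[i := False]))" by auto
  qed
  finally show ?thesis .
qed

section \<open>Restrictions\<close>

text \<open>Later entries win, so that prepending \<open>(i, b)\<close> to a history that already contains \<open>i\<close> has no
  effect.\<close>

definition hist_value :: "history \<Rightarrow> nat \<Rightarrow> bool \<Rightarrow> bool" where
  "hist_value h i b = fold (\<lambda>(j, v) a. if j = i then v else a) h b"

definition override :: "history \<Rightarrow> bool list \<Rightarrow> bool list" where
  "override h x = map (\<lambda>i. hist_value h i (x ! i)) [0..<length x]"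

lemma hist_value_Nil [simp]: "hist_value [] i b = b"
  by (simp add: hist_value_def)

lemma hist_value_Cons [simp]: "hist_value ((j, v) # h) i b = hist_value h i (if j = i then v else b)"
  by (simp add: hist_value_def)

lemma hist_value_append [simp]:
  "hist_value (h @ [(j, v)]) i b = (if j = i then v else hist_value h i b)"
  by (simp add: hist_value_def)

lemma hist_value_fresh: "i \<notin> fst ` set h \<Longrightarrow> hist_value h i b = b"
  by (induction h arbitrary: b) auto

lemma hist_value_known: "i \<in> fst ` set h \<Longrightarrow> hist_value h i b = hist_value h i b'"
proof (induction h arbitrary: b b')
  case (Cons a h)
  show ?case
  proof (cases "i \<in> fst ` set h")
    case True
    then show ?thesis by (cases a) (simp only: hist_value_Cons, rule Cons.IH)
  next
    case False
    then show ?thesis using Cons.prems by (cases a) (auto simp: hist_value_fresh)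
  qed
qed simp

lemma hist_value_consistent: "(\<And>j v. (j, v) \<in> set h \<Longrightarrow> x ! j = v) \<Longrightarrow> hist_value h i (x ! i) = x ! i"
proof (induction h)
  case (Cons a h)
  obtain j v where a: "a = (j, v)" by (cases a)
  then have "(if j = i then v else x ! i) = x ! i" using Cons.prems[of j v] by auto
  then show ?case using Cons a by simp
qed simp

lemma length_override [simp]: "length (override h x) = length x"
  by (simp add: override_def)

lemma override_cube [simp]: "x \<in> cube n \<Longrightarrow> override h x \<in> cube n"
  by (simp add: cube_def)

lemma nth_override [simp]: "i < length x \<Longrightarrow> override h x ! i = hist_value h i (x ! i)"
  by (simp add: override_def)

lemma override_Nil [simp]: "override [] x = x"
  by (simp add: list_eq_iff_nth_eq)

lemma override_Cons: "override ((i, b) # h) x = override h (x[i := b])"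
  by (auto simp: list_eq_iff_nth_eq nth_list_update)

lemma override_append: "override (h @ [(i, b)]) x = (override h x)[i := b]"
  by (auto simp: list_eq_iff_nth_eq nth_list_update)

lemma override_update: "i \<notin> fst ` set h \<Longrightarrow> override h (x[i := b]) = (override h x)[i := b]"
proof (rule nth_equalityI)
  fix j assume "i \<notin> fst ` set h" "j < length (override h (x[i := b]))"
  then show "override h (x[i := b]) ! j = (override h x)[i := b] ! j"
    by (cases "j = i") (simp_all add: hist_value_fresh)
qed simp

lemma override_update_known: "i \<in> fst ` set h \<Longrightarrow> override h (x[i := b]) = override h x"
proof (rule nth_equalityI)
  fix j assume "i \<in> fst ` set h" "j < length (override h (x[i := b]))"
  then show "override h (x[i := b]) ! j = override h x ! j"
    using hist_value_known[of i h b "x ! i"] by (cases "j = i") simp_all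
qed simp

lemma is_history_append: "is_history n h \<Longrightarrow> i < n \<Longrightarrow> i \<notin> fst ` set h \<Longrightarrow> is_history n (h @ [(i, b)])"
  by (auto simp: is_history_def)

lemma is_history_length:
  assumes "is_history n h"
  shows "length h \<le> n"
proof -
  have "length h = card (fst ` set h)"
    using assms distinct_card[of "map fst h"] by (simp add: is_history_def)
  also have "\<dots> \<le> card {..<n}"
    using assms by (intro card_mono) (auto simp: is_history_def)
  finally show ?thesis by simp
qed

lemma is_history_full:
  assumes "is_history n h" "n \<le> length h"
  shows "fst ` set h = {..<n}"
proof (rule card_subset_eq)
  show "card (fst ` set h) = card {..<n}"
    using assms is_history_length[OF assms(1)] distinct_card[of "map fst h"] by (simp add: is_history_def)
qed (use assms in \<open>auto simp: is_history_def\<close>)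

section \<open>Restricting a decision tree to a history\<close>

primrec prune :: "history \<Rightarrow> tree \<Rightarrow> tree" where
  "prune h (Leaf y) = Leaf y"
| "prune h (Node i l r) =
     (if i \<in> fst ` set h then if hist_value h i True then prune h r else prune h l
      else Node i (prune h l) (prune h r))"

lemma tree_vars_prune: "tree_vars (prune h t) \<subseteq> tree_vars t"
  by (induction t) auto

lemma read_once_prune: "read_once t \<Longrightarrow> read_once (prune h t)"
proof (induction t)
  case (Node i l r)
  then show ?case using tree_vars_prune[of h l] tree_vars_prune[of h r] by auto
qed simp

lemma tree_cost_prune: "tree_cost c (prune h t) \<le> tree_cost c t"
  by (induction t) auto

lemma tree_eval_prune:
  assumes "tree_vars t \<subseteq> {..<n}" "x \<in> cube n"
  shows "tree_eval (prune h t) x = tree_eval t (override h x)"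
  using assms
proof (induction t)
  case (Node i l r)
  then have "override h x ! i = hist_value h i (x ! i)" by (simp add: cube_def)
  then show ?case
    using Node hist_value_known[of i h "x ! i" True] hist_value_fresh[of i h "x ! i"] by auto
qed simp


section \<open>Decision trees from strategies\<close>

abbreviation hist_cost :: "nat list \<Rightarrow> history \<Rightarrow> nat" where
  "hist_cost c h \<equiv> (\<Sum>(i, b)\<leftarrow>h. c ! i)"

text \<open>Fixes the coins by picking some action of positive probability at each history; for a
  zero-error strategy any choice is correct. The leaf 0 mirrors the answer of \<open>play\<close>
  when its budget is exhausted.\<close>

primrec strategy_tree :: "strategy \<Rightarrow> nat \<Rightarrow> history \<Rightarrow> tree" where
  "strategy_tree S 0 h = Leaf 0"
| "strategy_tree S (Suc k) h = (case SOME a. a \<in> set_pmf (S h) of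
     Output y \<Rightarrow> Leaf y
   | Query i \<Rightarrow> Node i (strategy_tree S k (h @ [(i, False)])) (strategy_tree S k (h @ [(i, True)])))"

lemma some_action: "(SOME a. a \<in> set_pmf (S h)) \<in> set_pmf (S h)"
  by (rule someI_ex) (use set_pmf_not_empty[of "S h"] in blast)

lemma strategy_tree_wf:
  assumes "is_strategy n S" "is_history n h"
  shows "read_once (strategy_tree S k h) \<and> tree_vars (strategy_tree S k h) \<subseteq> {..<n} - fst ` set h"
  using assms(2)
proof (induction k arbitrary: h)
  case (Suc k)
  define a where "a = (SOME a. a \<in> set_pmf (S h))"
  have legal: "legal_action n h a"
    using assms(1) Suc.prems some_action[of S h] by (simp add: is_strategy_def a_def)
  show ?case
  proof (cases a)
    case (Query i)
    then have i: "i < n" "i \<notin> fst ` set h" using legal by (auto simp: legal_action_def)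
    then show ?thesis
      using Suc.IH[OF is_history_append[OF Suc.prems i], of True]
        Suc.IH[OF is_history_append[OF Suc.prems i], of False] Query
      unfolding a_def by auto
  next
    case (Output y)
    then show ?thesis using legal unfolding a_def by (auto simp: legal_action_def)
  qed
qed simp

text \<open>The run that takes the picked actions lies in the support, so what holds for all
  possible runs, correctness as well as the worst-case cost, carries over to the tree.\<close>

lemma strategy_tree_play:
  "\<exists>h'. (h', tree_eval (strategy_tree S k h) x) \<in> set_pmf (play k S x h)
     \<and> hist_cost c h' = hist_cost c h + path_cost c (strategy_tree S k h) x"
proof (induction k arbitrary: h)
  case (Suc k)
  define a where "a = (SOME a. a \<in> set_pmf (S h))"
  have a: "a \<in> set_pmf (S h)" by (simp add: a_def some_action)
  show ?case
  proof (cases a)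
    case (Query i)
    obtain h' where "(h', tree_eval (strategy_tree S k (h @ [(i, x ! i)])) x) \<in> set_pmf (play k S x (h @ [(i, x ! i)]))"
      "hist_cost c h' = hist_cost c (h @ [(i, x ! i)]) + path_cost c (strategy_tree S k (h @ [(i, x ! i)])) x"
      using Suc.IH by blast
    then show ?thesis
      using a Query unfolding a_def
      by (intro exI[of _ h'], cases "x ! i") (auto intro!: bexI[of _ "Query i"])
  next
    case (Output y)
    then show ?thesis
      using a unfolding a_def by (intro exI[of _ h]) (auto intro!: bexI[of _ "Output y"])
  qed
qed simp

lemma play_history:
  assumes "is_strategy n S" "is_history n h" "(h', y) \<in> set_pmf (play k S x h)"
  shows "is_history n h'"
  using assms(2,3)
proof (induction k arbitrary: h)
  case (Suc k)
  then obtain a where a: "a \<in> set_pmf (S h)"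
    and y: "(h', y) \<in> set_pmf (case a of Query i \<Rightarrow> play k S x (h @ [(i, x ! i)]) | Output y \<Rightarrow> return_pmf (h, y))"
    by auto
  have "legal_action n h a" using assms(1) Suc.prems a by (auto simp: is_strategy_def)
  then show ?case
    using y Suc.IH[OF is_history_append] Suc.prems by (cases a) (auto simp: legal_action_def)
qed simp

text \<open>A uniform bound on costs, which makes the set under \<open>Max\<close> in
  \<open>worst_case_cost\<close> finite.\<close>

lemma hist_cost_le:
  assumes "is_history n h" "length c = n"
  shows "hist_cost c h \<le> sum_list c"
proof -
  have "hist_cost c h = (\<Sum>i\<leftarrow>map fst h. c ! i)"
    by (simp add: comp_def case_prod_beta')
  also have "\<dots> = (\<Sum>i\<in>fst ` set h. c ! i)"
    using assms by (subst sum_list_distinct_conv_sum_set) (auto simp: is_history_def)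
  also have "\<dots> \<le> (\<Sum>i<n. c ! i)"
    using assms by (intro sum_mono2) (auto simp: is_history_def)
  also have "\<dots> = sum_list c"
    using assms by (simp add: sum_list_sum_nth atLeast0LessThan)
  finally show ?thesis .
qed

lemma cost_le_worst_case:
  assumes "is_strategy n S" "length c = n" "x \<in> cube n" "(h', y) \<in> set_pmf (run n S x)"
  shows "hist_cost c h' \<le> worst_case_cost n c S"
  unfolding worst_case_cost_def
proof (rule Max_ge)
  have "is_history n []" by (simp add: is_history_def)
  then have "hist_cost c h \<le> sum_list c" if "(h, y) \<in> set_pmf (play k S x [])" for h y k x
    using play_history[OF assms(1) _ that] hist_cost_le[OF _ assms(2)] by blast
  then show "finite (\<Union>x\<in>cube n. set_pmf (cost_pmf n c S x))"
    by (intro finite_subset[OF _ finite_atMost[of "sum_list c"]])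
       (auto simp: cost_pmf_def run_def simp del: play.simps)
  show "hist_cost c h' \<in> (\<Union>x\<in>cube n. set_pmf (cost_pmf n c S x))"
    using assms(3,4) by (force simp: cost_pmf_def)
qed

section \<open>Zero-error strategies and the optimum\<close>

lemma error_zero_iff:
  "error_prob n f S \<le> 0 \<longleftrightarrow> (\<forall>x\<in>cube n. \<forall>(h, y)\<in>set_pmf (run n S x). y = f x)"
proof -
  have "error_prob n f S \<le> 0 \<longleftrightarrow> error_prob n f S = 0"
    by (simp add: error_prob_def measure_le_0_iff)
  also have "\<dots> \<longleftrightarrow> (\<forall>x\<in>cube n. \<forall>(h, y)\<in>set_pmf (run n S x). y = f x)"
    by (fastforce simp: error_prob_def measure_pmf_zero_iff output_pmf_def set_pmf_of_set)
  finally show ?thesis .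
qed

text \<open>Witnesses that zero-error strategies exist, so that the infimum defining
  \<open>opt_worst\<close> at error 0 is attained.\<close>

definition query_all :: "nat \<Rightarrow> (bool list \<Rightarrow> int) \<Rightarrow> strategy" where
  "query_all n f h = return_pmf
     (if fst ` set h = {..<n} then Output (f (override h (replicate n False)))
      else Query (SOME i. i < n \<and> i \<notin> fst ` set h))"

lemma query_all_zero_error:
  assumes "f \<in> cube n \<rightarrow> {-1, 1}"
  shows "error_strategy n f 0 (query_all n f)"
proof -
  have fresh: "(SOME i. i < n \<and> i \<notin> fst ` set h) < n \<and> (SOME i. i < n \<and> i \<notin> fst ` set h) \<notin> fst ` set h"
    if "is_history n h" "fst ` set h \<noteq> {..<n}" for h :: history
    by (rule someI_ex[of "\<lambda>i. i < n \<and> i \<notin> fst ` set h"]) (use that in \<open>auto simp: is_history_def\<close>)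
  have "f (override h (replicate n False)) \<in> {-1, 1}" for h
    using assms override_cube[of "replicate n False" n h] by (auto simp: cube_def Pi_def)
  then have strat: "is_strategy n (query_all n f)"
    using fresh by (auto simp: is_strategy_def query_all_def legal_action_def)
  \<comment> \<open>The budget \<open>k\<close> exceeds the number of unknown coordinates, which
    leaves one action for the output; the default answer 0 of \<open>play\<close> is never
    reached.\<close>
  have "y = f x" if "x \<in> cube n" "is_history n h" "\<And>i b. (i, b) \<in> set h \<Longrightarrow> x ! i = b" "n - length h < k"
    "(h', y) \<in> set_pmf (play k (query_all n f) x h)" for x h h' y k
    using that(2-)
  proof (induction k arbitrary: h)
    case (Suc k)
    show ?case
    proof (cases "fst ` set h = {..<n}")
      case True
      have "override h (replicate n False) ! i = x ! i" if "i < n" for i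
        using hist_value_known[of i h False "x ! i"] hist_value_consistent[of h x i] that True Suc.prems
        by simp
      then have "override h (replicate n False) = x"
        using \<open>x \<in> cube n\<close> by (simp add: list_eq_iff_nth_eq cube_def)
      then show ?thesis using Suc.prems True by (simp add: query_all_def bind_return_pmf)
    next
      case False
      define i where "i = (SOME i. i < n \<and> i \<notin> fst ` set h)"
      have i: "i < n" "i \<notin> fst ` set h" using fresh[OF Suc.prems(1) False] by (auto simp: i_def)
      have "length h < n" using False is_history_full[OF Suc.prems(1)] by force
      then show ?thesis
        using Suc.prems False i is_history_append[OF Suc.prems(1) i]
        by (intro Suc.IH[of "h @ [(i, x ! i)]"]) (auto simp: query_all_def bind_return_pmf i_def)
    qed
  qed simp
  from this[of _ "[]" "Suc n"] have "\<forall>x\<in>cube n. \<forall>(h, y)\<in>set_pmf (run n (query_all n f) x). y = f x"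
    by (auto simp: run_def is_history_def)
  then show ?thesis
    using strat error_zero_iff by (simp add: error_strategy_def)
qed

lemma opt_worst_tree:
  assumes "f \<in> cube n \<rightarrow> {-1, 1}" "length c = n"
  obtains t where "read_once t" "tree_vars t \<subseteq> {..<n}" "\<And>x. x \<in> cube n \<Longrightarrow> tree_eval t x = f x"
    "tree_cost c t \<le> opt_worst n f c 0"
proof -
  have "opt_worst n f c 0 \<in> worst_case_cost n c ` {S. error_strategy n f 0 S}"
    unfolding opt_worst_def using query_all_zero_error[OF assms(1)] by (intro Inf_nat_def1) blast
  then obtain S where S: "is_strategy n S" "error_prob n f S \<le> 0"
    and opt: "opt_worst n f c 0 = worst_case_cost n c S"
    by (auto simp: error_strategy_def)
  define t where "t = strategy_tree S (Suc n) []"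
  have t: "read_once t" "tree_vars t \<subseteq> {..<n}"
    using strategy_tree_wf[OF S(1), of "[]" "Suc n"] by (auto simp: t_def is_history_def)
  have run: "\<exists>h'. (h', tree_eval t x) \<in> set_pmf (run n S x) \<and> hist_cost c h' = path_cost c t x" for x
    using strategy_tree_play[of S "Suc n" "[]" x c] unfolding run_def t_def by (simp del: play.simps strategy_tree.simps)
  have "tree_eval t x = f x" if "x \<in> cube n" for x
    using run[of x] S that error_zero_iff[of n f S] by fastforce
  moreover have "path_cost c t x \<le> opt_worst n f c 0" if "x \<in> cube n" for x
    using run[of x] cost_le_worst_case[OF S(1) assms(2) that] opt by metis
  then have "tree_cost c t \<le> opt_worst n f c 0"
    using tree_cost_attained[OF t, of c] by metis
  ultimately show ?thesis using t that by blast
qed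

text \<open>Pruning does not raise the cost, so every restriction is charged against the optimum of
  the unrestricted function.\<close>

lemma opt_worst_restricted:
  assumes "f \<in> cube n \<rightarrow> {-1, 1}" "length c = n"
  obtains t where "read_once t" "tree_vars t \<subseteq> {..<n}"
    "\<And>x. x \<in> cube n \<Longrightarrow> tree_eval t x = f (override h x)" "tree_cost c t \<le> opt_worst n f c 0"
proof -
  obtain t where t: "read_once t" "tree_vars t \<subseteq> {..<n}" "\<And>x. x \<in> cube n \<Longrightarrow> tree_eval t x = f x"
    "tree_cost c t \<le> opt_worst n f c 0"
    using opt_worst_tree[OF assms] by metis
  show ?thesis
    using t tree_vars_prune[of h t] read_once_prune[OF t(1)] tree_cost_prune[of c h t] tree_eval_prune[OF t(2)]
    by (intro that[of "prune h t"]) auto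
qed

section \<open>Polynomial time\<close>

text \<open>Measuring the time by \<open>sz a\<close> rather than by the size of the input makes this notion closed under
  composition without any bound on the sizes of intermediate results.\<close>

definition feasible :: "'a set \<Rightarrow> ('a \<Rightarrow> nat) \<Rightarrow> ('a \<Rightarrow> data) \<Rightarrow> ('a \<Rightarrow> data) \<Rightarrow> bool" where
  "feasible A sz inp out \<longleftrightarrow>
     (\<exists>P (p :: nat poly). \<forall>a\<in>A. halts_within P (inp a) (poly p (sz a)) (out a))"

text \<open>Numbers are stored in binary, so a feasible number may be exponentially large. Loop
  counts and list indices therefore carry this separate bound.\<close>

definition poly_bounded :: "'a set \<Rightarrow> ('a \<Rightarrow> nat) \<Rightarrow> ('a \<Rightarrow> nat) \<Rightarrow> bool" where
  "poly_bounded A sz l \<longleftrightarrow> (\<exists>p :: nat poly. \<forall>a\<in>A. l a \<le> poly p (sz a))"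

lemma poly_nat_mono: "x \<le> y \<Longrightarrow> poly p x \<le> poly p y" for p :: "nat poly"
  by (induction p) (auto intro!: add_mono mult_mono)

lemma poly_bounded_mono: "poly_bounded A sz l \<Longrightarrow> (\<And>a. a \<in> A \<Longrightarrow> k a \<le> l a) \<Longrightarrow> poly_bounded A sz k"
  unfolding poly_bounded_def by (meson order_trans)

lemma poly_bounded_const: "poly_bounded A sz (\<lambda>a. k)"
  unfolding poly_bounded_def by (intro exI[of _ "[:k:]"]) simp

lemma poly_bounded_add: "poly_bounded A sz k \<Longrightarrow> poly_bounded A sz l \<Longrightarrow> poly_bounded A sz (\<lambda>a. k a + l a)"
  unfolding poly_bounded_def by (metis add_mono poly_add)

lemma poly_bounded_mult: "poly_bounded A sz k \<Longrightarrow> poly_bounded A sz l \<Longrightarrow> poly_bounded A sz (\<lambda>a. k a * l a)"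
  unfolding poly_bounded_def by (metis mult_le_mono poly_mult)

lemma poly_bounded_power: "poly_bounded A sz k \<Longrightarrow> poly_bounded A sz (\<lambda>a. k a ^ d)"
  unfolding poly_bounded_def by (metis poly_power power_mono zero_le)

text \<open>Inside a loop the argument is an instance paired with the counter, while the size stays
  that of the instance.\<close>

lemma poly_bounded_Sigma:
  "poly_bounded A sz l \<Longrightarrow> poly_bounded (Sigma A B) (\<lambda>z. sz (fst z)) (\<lambda>z. l (fst z))"
  unfolding poly_bounded_def by fastforce

lemma poly_bounded_index:
  "poly_bounded A sz l \<Longrightarrow> poly_bounded (Sigma A (\<lambda>a. {..<l a})) (\<lambda>z. sz (fst z)) snd"
  by (rule poly_bounded_mono[OF poly_bounded_Sigma]) auto

lemmas poly_bounded_intros = poly_bounded_const poly_bounded_add poly_bounded_mult poly_bounded_power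

lemma halts_within_mono: "halts_within P u s v \<Longrightarrow> s \<le> t \<Longrightarrow> halts_within P u t v"
  unfolding halts_within_def by (meson order_trans)

lemma halts_within_Seq:
  assumes "halts_within P u s v" "halts_within Q v t w"
  shows "halts_within (Seq P Q) u (s + t + 1) w"
proof -
  obtain s' t' where "s' \<le> s" "exec P u s' v" "t' \<le> t" "exec Q v t' w"
    using assms by (auto simp: halts_within_def)
  then show ?thesis
    unfolding halts_within_def by (intro exI[of _ "s' + t' + 1"]) (simp add: exec.Seq[simplified])
qed

lemma halts_within_Both:
  assumes "halts_within P u s v" "halts_within Q u t w"
  shows "halts_within (Both P Q) u (s + t + 1) (Join v w)"
proof -
  obtain s' t' where "s' \<le> s" "exec P u s' v" "t' \<le> t" "exec Q u t' w"
    using assms by (auto simp: halts_within_def)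
  then show ?thesis
    unfolding halts_within_def by (intro exI[of _ "s' + t' + 1"]) (simp add: exec.Both[simplified])
qed

lemma halts_within_Cond:
  assumes "halts_within B u s b" "b \<noteq> Atom 0 \<Longrightarrow> halts_within P u t v" "b = Atom 0 \<Longrightarrow> halts_within Q u t v"
  shows "halts_within (Cond B P Q) u (s + t + 1) v"
proof -
  obtain s' where s: "s' \<le> s" "exec B u s' b"
    using assms by (auto simp: halts_within_def)
  obtain t' where "t' \<le> t" "exec (if b = Atom 0 then Q else P) u t' v"
    using assms(2,3) by (cases "b = Atom 0") (auto simp: halts_within_def)
  with s show ?thesis
    unfolding halts_within_def
    by (intro exI[of _ "s' + t' + 1"])
       (auto split: if_splits intro: exec.Cond_True[simplified] exec.Cond_False[simplified])
qed

lemma halts_within_While: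
  assumes "\<And>j. j \<le> l \<Longrightarrow> halts_within B (s j) tb (b j)" "\<And>j. j \<le> l \<Longrightarrow> b j \<noteq> Atom 0 \<longleftrightarrow> j < l"
    "\<And>j. j < l \<Longrightarrow> halts_within P (s j) tp (s (Suc j))"
  shows "halts_within (While B P) (s 0) (l * (tb + tp + 1) + tb + 1) (s l)"
  using assms
proof (induction l arbitrary: s b)
  case 0
  then obtain t where "t \<le> tb" "exec B (s 0) t (Atom 0)"
    by (force simp: halts_within_def)
  then show ?case
    unfolding halts_within_def by (intro exI[of _ "t + 1"]) (auto intro: exec.While_False[simplified])
next
  case (Suc l)
  have "halts_within (While B P) (s (Suc 0)) (l * (tb + tp + 1) + tb + 1) (s (Suc l))"
    using Suc.prems by (intro Suc.IH[of "\<lambda>j. s (Suc j)" "\<lambda>j. b (Suc j)"]) auto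
  then obtain r where r: "r \<le> l * (tb + tp + 1) + tb + 1" "exec (While B P) (s (Suc 0)) r (s (Suc l))"
    by (auto simp: halts_within_def)
  obtain t where t: "t \<le> tb" "exec B (s 0) t (b 0)" using Suc.prems(1)[of 0] by (auto simp: halts_within_def)
  obtain t' where t': "t' \<le> tp" "exec P (s 0) t' (s (Suc 0))" using Suc.prems(3)[of 0] by (auto simp: halts_within_def)
  have "exec (While B P) (s 0) (t + t' + r + 1) (s (Suc l))"
    using exec.While_True[OF t(2) _ t'(2) r(2)] Suc.prems(2)[of 0] by simp
  moreover have "t + t' + r + 1 \<le> Suc l * (tb + tp + 1) + tb + 1"
    using r(1) t(1) t'(1) by simp
  ultimately show ?case
    unfolding halts_within_def by blast
qed

lemma feasible_cong:
  assumes "feasible A sz inp X" "\<And>a. a \<in> A \<Longrightarrow> X a = Y a"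
  shows "feasible A sz inp Y"
  using assms by (simp add: feasible_def)

lemma feasible_trans:
  assumes "feasible A sz X Y" "feasible A sz Y Z"
  shows "feasible A sz X Z"
proof -
  obtain P Q p q where "\<And>a. a \<in> A \<Longrightarrow> halts_within P (X a) (poly p (sz a)) (Y a)"
    "\<And>a. a \<in> A \<Longrightarrow> halts_within Q (Y a) (poly q (sz a)) (Z a)"
    using assms unfolding feasible_def by metis
  from halts_within_Seq[OF this] show ?thesis
    unfolding feasible_def by (intro exI[of _ "Seq P Q"] exI[of _ "p + q + [:1:]"]) simp
qed

lemma feasible_Join:
  assumes "feasible A sz inp X" "feasible A sz inp Y"
  shows "feasible A sz inp (\<lambda>a. Join (X a) (Y a))"
proof -
  obtain P Q p q where "\<And>a. a \<in> A \<Longrightarrow> halts_within P (inp a) (poly p (sz a)) (X a)"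
    "\<And>a. a \<in> A \<Longrightarrow> halts_within Q (inp a) (poly q (sz a)) (Y a)"
    using assms unfolding feasible_def by metis
  from halts_within_Both[OF this] show ?thesis
    unfolding feasible_def by (intro exI[of _ "Both P Q"] exI[of _ "p + q + [:1:]"]) simp
qed

lemma feasible_step:
  assumes "feasible A sz inp X" "\<And>u. exec P u 1 (F u)"
  shows "feasible A sz inp (\<lambda>a. F (X a))"
proof (rule feasible_trans[OF assms(1)])
  show "feasible A sz X (\<lambda>a. F (X a))"
    unfolding feasible_def halts_within_def
    by (intro exI[of _ P] exI[of _ "[:1:]"]) (use assms(2) in force)
qed

lemma feasible_id: "feasible A sz inp inp"
  unfolding feasible_def halts_within_def
  by (intro exI[of _ Ident] exI[of _ "[:1:]"]) (use exec.Ident in force)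

lemma feasible_const: "feasible A sz inp (\<lambda>a. Atom k)"
  using feasible_step[OF feasible_id exec.Constant] .

lemma feasible_left: "feasible A sz inp X \<Longrightarrow> feasible A sz inp (\<lambda>a. left (X a))"
  by (rule feasible_step[OF _ exec.Left])

lemma feasible_right: "feasible A sz inp X \<Longrightarrow> feasible A sz inp (\<lambda>a. right (X a))"
  by (rule feasible_step[OF _ exec.Right])

lemma feasible_fst: "feasible A sz inp (\<lambda>a. Join (X a) (Y a)) \<Longrightarrow> feasible A sz inp X"
  by (drule feasible_left) simp

lemma feasible_snd: "feasible A sz inp (\<lambda>a. Join (X a) (Y a)) \<Longrightarrow> feasible A sz inp Y"
  by (drule feasible_right) simp

lemma feasible_add:
  assumes "feasible A sz inp (\<lambda>a. Atom (x a))" "feasible A sz inp (\<lambda>a. Atom (y a))"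
  shows "feasible A sz inp (\<lambda>a. Atom (x a + y a))"
  using feasible_step[OF feasible_Join[OF assms] exec.Plus] by simp

lemma feasible_diff:
  assumes "feasible A sz inp (\<lambda>a. Atom (x a))" "feasible A sz inp (\<lambda>a. Atom (y a))"
  shows "feasible A sz inp (\<lambda>a. Atom (x a - y a))"
  using feasible_step[OF feasible_Join[OF assms] exec.Minus] by simp

lemma feasible_if:
  assumes "feasible A sz inp B" "\<And>a. a \<in> A \<Longrightarrow> B a \<noteq> Atom 0 \<longleftrightarrow> b a"
    "feasible A sz inp X" "feasible A sz inp Y"
  shows "feasible A sz inp (\<lambda>a. if b a then X a else Y a)"
proof -
  obtain P Q R p q r where B: "\<And>a. a \<in> A \<Longrightarrow> halts_within P (inp a) (poly p (sz a)) (B a)"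
    and XY: "\<And>a. a \<in> A \<Longrightarrow> halts_within Q (inp a) (poly q (sz a)) (X a)"
      "\<And>a. a \<in> A \<Longrightarrow> halts_within R (inp a) (poly r (sz a)) (Y a)"
    using assms(1,3,4) unfolding feasible_def by metis
  have "halts_within (Cond P Q R) (inp a) (poly p (sz a) + (poly q (sz a) + poly r (sz a)) + 1)
      (if b a then X a else Y a)" if "a \<in> A" for a
    using assms(2)[OF that] XY[OF that]
    by (intro halts_within_Cond[OF B[OF that]]) (auto elim: halts_within_mono)
  then show ?thesis
    unfolding feasible_def by (intro exI[of _ "Cond P Q R"] exI[of _ "p + (q + r) + [:1:]"]) simp
qed

lemma enc_bool_nonzero: "enc_bool b \<noteq> Atom 0 \<longleftrightarrow> b"
  by (simp add: enc_bool_def)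

lemma feasible_if_bool:
  assumes "feasible A sz inp (\<lambda>a. enc_bool (b a))" "feasible A sz inp X" "feasible A sz inp Y"
  shows "feasible A sz inp (\<lambda>a. if b a then X a else Y a)"
  by (rule feasible_if[OF assms(1) _ assms(2,3)]) (rule enc_bool_nonzero)

lemma feasible_nonzero:
  assumes "feasible A sz inp (\<lambda>a. Atom (x a))"
  shows "feasible A sz inp (\<lambda>a. enc_bool (x a \<noteq> 0))"
  by (rule feasible_cong[OF feasible_if[OF assms, of "\<lambda>a. x a \<noteq> 0" "\<lambda>a. Atom 1" "\<lambda>a. Atom 0"]])
     (auto simp: enc_bool_def intro: feasible_const)

lemma feasible_enc_const: "feasible A sz inp (\<lambda>a. enc_bool b)"
  unfolding enc_bool_def by (rule feasible_const)

lemma feasible_not: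
  assumes "feasible A sz inp (\<lambda>a. enc_bool (b a))"
  shows "feasible A sz inp (\<lambda>a. enc_bool (\<not> b a))"
  by (rule feasible_cong[OF feasible_if_bool[OF assms feasible_enc_const[of _ _ _ False] feasible_enc_const[of _ _ _ True]]]) auto

lemma feasible_or:
  assumes "feasible A sz inp (\<lambda>a. enc_bool (b a))" "feasible A sz inp (\<lambda>a. enc_bool (d a))"
  shows "feasible A sz inp (\<lambda>a. enc_bool (b a \<or> d a))"
  by (rule feasible_cong[OF feasible_if_bool[OF assms(1) feasible_enc_const[of _ _ _ True] assms(2)]]) auto

lemma feasible_neq_bool:
  assumes "feasible A sz inp (\<lambda>a. enc_bool (b a))" "feasible A sz inp (\<lambda>a. enc_bool (d a))"
  shows "feasible A sz inp (\<lambda>a. enc_bool (b a \<noteq> d a))"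
  by (rule feasible_cong[OF feasible_if_bool[OF assms(1) feasible_not[OF assms(2)] assms(2)]]) auto

lemma feasible_less:
  assumes "feasible A sz inp (\<lambda>a. Atom (x a))" "feasible A sz inp (\<lambda>a. Atom (y a))"
  shows "feasible A sz inp (\<lambda>a. enc_bool (x a < y a))"
  by (rule feasible_cong[OF feasible_nonzero[OF feasible_diff[OF assms(2,1)]]]) (simp add: enc_bool_def)

lemma feasible_neq:
  assumes "feasible A sz inp (\<lambda>a. Atom (x a))" "feasible A sz inp (\<lambda>a. Atom (y a))"
  shows "feasible A sz inp (\<lambda>a. enc_bool (x a \<noteq> y a))"
  by (rule feasible_cong[OF feasible_or[OF feasible_less[OF assms] feasible_less[OF assms(2,1)]]])
     (auto simp: enc_bool_def)


subsection \<open>Loops\<close>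

text \<open>The original input travels with counter and state, so that the guard and the body can
  recompute from it whatever they need.\<close>

abbreviation loop_input :: "('a \<Rightarrow> data) \<Rightarrow> ('a \<Rightarrow> nat \<Rightarrow> data) \<Rightarrow> 'a \<times> nat \<Rightarrow> data" where
  "loop_input inp s \<equiv> \<lambda>z. Join (Atom (snd z)) (Join (s (fst z) (snd z)) (inp (fst z)))"

text \<open>The guard is the truncated difference of \<open>l a\<close> and the counter, with
  \<open>l a\<close> recomputed from the saved input. Prescribing the whole sequence of states
  reduces the body to a single feasibility claim, from state \<open>j\<close> to state
  \<open>Suc j\<close>.\<close>

lemma feasible_for:
  assumes len: "feasible A sz inp (\<lambda>a. Atom (l a))" "poly_bounded A sz l"
    and init: "feasible A sz inp (\<lambda>a. s a 0)"
    and body: "feasible (Sigma A (\<lambda>a. {..<l a})) (\<lambda>z. sz (fst z)) (loop_input inp s)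
      (\<lambda>z. s (fst z) (Suc (snd z)))"
  shows "feasible A sz inp (\<lambda>a. s a (l a))"
proof -
  obtain PL pl where PL: "\<And>a. a \<in> A \<Longrightarrow> halts_within PL (inp a) (poly pl (sz a)) (Atom (l a))"
    using len(1) unfolding feasible_def by metis
  obtain PB pb where PB: "\<And>a j. a \<in> A \<Longrightarrow> j < l a \<Longrightarrow>
      halts_within PB (loop_input inp s (a, j)) (poly pb (sz a)) (s a (Suc j))"
    using body unfolding feasible_def by (metis (no_types, lifting) SigmaI fst_conv lessThan_iff snd_conv)
  obtain q where q: "\<And>a. a \<in> A \<Longrightarrow> l a \<le> poly q (sz a)"
    using len(2) unfolding poly_bounded_def by metis
  define B where "B = Seq (Both (Seq (Seq Right Right) PL) Left) Minus"
  define P where "P = Both (Seq (Both Left (Constant 1)) Plus) (Both PB (Seq Right Right))"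
  have step: "halts_within Left u 1 (left u)" "halts_within Right u 1 (right u)"
    "halts_within (Constant k) u 1 (Atom k)" "halts_within Minus u 1 (minus_data u)"
    "halts_within Plus u 1 (plus_data u)" for u k
    unfolding halts_within_def using exec.intros(2-4,6,7) by (metis order_refl)+
  \<comment> \<open>The summands 8 and 10 count the steps that \<open>B\<close> and \<open>P\<close>
    spend besides \<open>PL\<close> and \<open>PB\<close>.\<close>
  have loop: "halts_within (While B P) (loop_input inp s (a, 0))
      (poly (q * ((pl + [:8:]) + (pb + [:10:]) + [:1:]) + (pl + [:8:]) + [:1:]) (sz a)) (loop_input inp s (a, l a))"
    if a: "a \<in> A" for a
  proof -
    have RR: "halts_within (Seq Right Right) (loop_input inp s (a, j)) 3 (inp a)" for j
      using halts_within_Seq[OF step(2,2), of "loop_input inp s (a, j)"] by (simp add: numeral_eq_Suc)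
    have "halts_within B (loop_input inp s (a, j)) (poly pl (sz a) + 8) (Atom (l a - j))" for j
      using halts_within_Seq[OF halts_within_Both[OF halts_within_Seq[OF RR PL[OF a]] step(1)] step(4), of j]
      unfolding B_def by (auto elim: halts_within_mono)
    moreover have "halts_within P (loop_input inp s (a, j)) (poly pb (sz a) + 10) (loop_input inp s (a, Suc j))"
      if "j < l a" for j
      using halts_within_Both[OF halts_within_Seq[OF halts_within_Both[OF step(1) step(3)[of 1]] step(5)]
          halts_within_Both[OF PB[OF a that] RR]]
      unfolding P_def by (auto elim: halts_within_mono)
    ultimately have "halts_within (While B P) (loop_input inp s (a, 0))
        (l a * ((poly pl (sz a) + 8) + (poly pb (sz a) + 10) + 1) + (poly pl (sz a) + 8) + 1) (loop_input inp s (a, l a))"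
      by (intro halts_within_While[of _ _ "\<lambda>j. loop_input inp s (a, j)" _ "\<lambda>j. Atom (l a - j)"]) auto
    then show ?thesis
      by (rule halts_within_mono) (use q[OF a] in \<open>simp add: add_mono mult_le_mono\<close>)
  qed
  have "feasible A sz (\<lambda>a. loop_input inp s (a, 0)) (\<lambda>a. loop_input inp s (a, l a))"
    unfolding feasible_def using loop by blast
  moreover have "feasible A sz inp (\<lambda>a. loop_input inp s (a, 0))"
    using feasible_Join[OF feasible_const[of A sz inp 0] feasible_Join[OF init feasible_id]] by simp
  ultimately have "feasible A sz inp (\<lambda>a. loop_input inp s (a, l a))"
    by (rule feasible_trans[rotated])
  then show ?thesis
    by simp (drule feasible_snd, drule feasible_fst)
qed

text \<open>Lets whatever is computable from the outer input be reused in a loop body.\<close>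

lemma feasible_outer:
  assumes "feasible A sz inp X"
  shows "feasible (Sigma A B) (\<lambda>z. sz (fst z)) (loop_input inp s) (\<lambda>z. X (fst z))"
proof -
  have "feasible (Sigma A B) (\<lambda>z. sz (fst z)) (\<lambda>z. inp (fst z)) (\<lambda>z. X (fst z))"
    using assms unfolding feasible_def by fastforce
  from feasible_trans[OF feasible_snd[OF feasible_snd[OF feasible_id]] this] show ?thesis .
qed

lemma feasible_counter: "feasible (Sigma A B) (\<lambda>z. sz (fst z)) (loop_input inp s) (\<lambda>z. Atom (snd z))"
  by (rule feasible_fst[OF feasible_id])

lemma feasible_state: "feasible (Sigma A B) (\<lambda>z. sz (fst z)) (loop_input inp s) (\<lambda>z. s (fst z) (snd z))"
  by (rule feasible_fst[OF feasible_snd[OF feasible_id]])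

lemma feasible_sum:
  assumes "feasible A sz inp (\<lambda>a. Atom (l a))" "poly_bounded A sz l"
    "feasible (Sigma A (\<lambda>a. {..<l a})) (\<lambda>z. sz (fst z)) (loop_input inp (\<lambda>a j. Atom (\<Sum>i<j. x a i)))
      (\<lambda>z. Atom (x (fst z) (snd z)))"
  shows "feasible A sz inp (\<lambda>a. Atom (\<Sum>i<l a. x a i))"
  by (rule feasible_for[OF assms(1,2)])
     (use feasible_add[OF feasible_state assms(3)] feasible_const[of A sz inp 0] in simp_all)

text \<open>The language only adds, so a product is a loop over its first factor. The second factor
  may be large, such as a cost written in binary.\<close>

lemma feasible_mult:
  assumes "feasible A sz inp (\<lambda>a. Atom (x a))" "poly_bounded A sz x" "feasible A sz inp (\<lambda>a. Atom (y a))"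
  shows "feasible A sz inp (\<lambda>a. Atom (x a * y a))"
  using feasible_sum[OF assms(1,2) feasible_outer[OF assms(3)]] by simp

lemma enc_list_simps [simp]:
  "enc_list e [] = Atom 0" "enc_list e (x # xs) = Join (e x) (enc_list e xs)"
  by (simp_all add: enc_list_def)

lemma right_enc_list: "right (enc_list e xs) = enc_list e (tl xs)"
  by (cases xs) auto

lemma feasible_drop:
  assumes "feasible A sz inp (\<lambda>a. enc_list e (xs a))" "feasible A sz inp (\<lambda>a. Atom (k a))" "poly_bounded A sz k"
  shows "feasible A sz inp (\<lambda>a. enc_list e (drop (k a) (xs a)))"
proof (rule feasible_for[OF assms(2,3), of "\<lambda>a j. enc_list e (drop j (xs a))"])
  show "feasible A sz inp (\<lambda>a. enc_list e (drop 0 (xs a)))"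
    using assms(1) by simp
  show "feasible (Sigma A (\<lambda>a. {..<k a})) (\<lambda>z. sz (fst z)) (loop_input inp (\<lambda>a j. enc_list e (drop j (xs a))))
      (\<lambda>z. enc_list e (drop (Suc (snd z)) (xs (fst z))))"
    using feasible_right[OF feasible_state[of A _ sz "\<lambda>a j. enc_list e (drop j (xs a))" inp]]
    by (simp add: right_enc_list drop_Suc tl_drop)
qed

lemma feasible_nth:
  assumes "feasible A sz inp (\<lambda>a. enc_list e (xs a))" "feasible A sz inp (\<lambda>a. Atom (k a))" "poly_bounded A sz k"
    "\<And>a. a \<in> A \<Longrightarrow> k a < length (xs a)"
  shows "feasible A sz inp (\<lambda>a. e (xs a ! k a))"
  by (rule feasible_cong[OF feasible_left[OF feasible_drop[OF assms(1-3)]]])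
     (simp add: assms(4) Cons_nth_drop_Suc[symmetric])

text \<open>A counting loop would need the length as its bound; instead the loop consumes the list
  and uses the remaining list itself as its guard.\<close>

lemma feasible_length:
  assumes "feasible A sz inp (\<lambda>a. enc_list e (xs a))" "poly_bounded A sz (\<lambda>a. length (xs a))"
  shows "feasible A sz inp (\<lambda>a. Atom (length (xs a)))"
proof -
  obtain q where q: "\<And>a. a \<in> A \<Longrightarrow> length (xs a) \<le> poly q (sz a)"
    using assms(2) unfolding poly_bounded_def by metis
  define s where "s = (\<lambda>a j. Join (Atom j) (enc_list e (drop j (xs a))))"
  define P where "P = Both (Seq (Both Left (Constant 1)) Plus) (Seq Right Right)"
  have step: "halts_within Left u 1 (left u)" "halts_within Right u 1 (right u)"
    "halts_within (Constant k) u 1 (Atom k)" "halts_within Plus u 1 (plus_data u)" for u k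
    unfolding halts_within_def using exec.intros(2-4,6) by (metis order_refl)+
  have "halts_within P (s a j) 9 (s a (Suc j))" for a j
    using halts_within_Both[OF halts_within_Seq[OF halts_within_Both[OF step(1) step(3)[of 1]] step(4)]
        halts_within_Seq[OF step(2,2)], of "s a j"]
    unfolding P_def s_def by (simp add: right_enc_list drop_Suc tl_drop numeral_eq_Suc)
  moreover have "halts_within Right (s a j) 1 (enc_list e (drop j (xs a)))" for a j
    using step(2)[of "s a j"] by (simp add: s_def)
  moreover have "enc_list e (drop j (xs a)) \<noteq> Atom 0 \<longleftrightarrow> j < length (xs a)" for a j
    by (cases "drop j (xs a)") (auto simp: drop_eq_Nil dest: arg_cong[of _ _ length])
  ultimately have "halts_within (While Right P) (s a 0) (length (xs a) * (1 + 9 + 1) + 1 + 1) (s a (length (xs a)))" for a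
    by (intro halts_within_While[where b = "\<lambda>j. enc_list e (drop j (xs a))"]) blast+
  then have "halts_within (While Right P) (s a 0) (poly (q * [:11:] + [:2:]) (sz a)) (s a (length (xs a)))"
    if "a \<in> A" for a
    by (rule halts_within_mono) (use q[OF that] in simp)
  then have "feasible A sz (\<lambda>a. s a 0) (\<lambda>a. s a (length (xs a)))"
    unfolding feasible_def by blast
  moreover have "feasible A sz inp (\<lambda>a. s a 0)"
    unfolding s_def using feasible_Join[OF feasible_const[of A sz inp 0] assms(1)] by simp
  ultimately have "feasible A sz inp (\<lambda>a. s a (length (xs a)))"
    by (rule feasible_trans[rotated])
  then show ?thesis
    unfolding s_def by (rule feasible_fst)
qed

text \<open>Encoded lists grow at the front, so round \<open>j\<close> produces the entry with index
  \<open>l - Suc j\<close>.\<close>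

lemma feasible_map_upt:
  assumes "feasible A sz inp (\<lambda>a. Atom (l a))" "poly_bounded A sz l"
    "\<And>s. feasible (Sigma A (\<lambda>a. {..<l a})) (\<lambda>z. sz (fst z)) (loop_input inp s)
      (\<lambda>z. e (x (fst z) (l (fst z) - Suc (snd z))))"
  shows "feasible A sz inp (\<lambda>a. enc_list e (map (x a) [0..<l a]))"
proof -
  define s where "s = (\<lambda>a j. enc_list e (map (x a) [l a - j..<l a]))"
  have "feasible A sz inp (\<lambda>a. s a (l a))"
  proof (rule feasible_for[OF assms(1,2)])
    show "feasible A sz inp (\<lambda>a. s a 0)"
      by (simp add: s_def feasible_const)
    show "feasible (Sigma A (\<lambda>a. {..<l a})) (\<lambda>z. sz (fst z)) (loop_input inp s) (\<lambda>z. s (fst z) (Suc (snd z)))"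
    proof (rule feasible_cong[OF feasible_Join[OF assms(3) feasible_state]])
      fix z assume "z \<in> Sigma A (\<lambda>a. {..<l a})"
      then have "snd z < l (fst z)" by auto
      then have "[l (fst z) - Suc (snd z)..<l (fst z)] = (l (fst z) - Suc (snd z)) # [l (fst z) - snd z..<l (fst z)]"
        by (subst upt_conv_Cons) (auto simp: Suc_diff_Suc)
      then show "Join (e (x (fst z) (l (fst z) - Suc (snd z)))) (s (fst z) (snd z)) = s (fst z) (Suc (snd z))"
        by (simp add: s_def)
    qed
  qed
  then show ?thesis by (simp add: s_def)
qed

section \<open>The strategy\<close>

text \<open>One sample is one block of \<open>n\<close> random bits. It is uniform on the whole cube
  and is made consistent with a history only afterwards, by \<open>override\<close>.\<close>

definition block :: "nat \<Rightarrow> bool list \<Rightarrow> nat \<Rightarrow> bool list" where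
  "block n r j = map (\<lambda>i. r ! (n * j + i)) [0..<n]"

definition hits :: "nat \<Rightarrow> nat \<Rightarrow> (bool list \<Rightarrow> bool) \<Rightarrow> bool list \<Rightarrow> nat" where
  "hits n m Q r = (\<Sum>j<m. of_bool (Q (block n r j)))"

text \<open>If \<open>i\<close> already occurs in \<open>h\<close> the two sides agree, so a
  coordinate that was seen to be sensitive is automatically a fresh one.\<close>

abbreviation sensitive :: "(bool list \<Rightarrow> bool) \<Rightarrow> history \<Rightarrow> nat \<Rightarrow> bool list \<Rightarrow> bool" where
  "sensitive g h i x \<equiv> g (override ((i, True) # h) x) \<noteq> g (override ((i, False) # h) x)"

text \<open>The triple consists of an index maximising \<open>u i / c ! i\<close>, its value of \<open>u\<close> and its cost; the initial
  triple stands for ``none'' and is beaten exactly by the indices with \<open>u i > 0\<close>.\<close>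

primrec best :: "(nat \<Rightarrow> nat) \<Rightarrow> nat list \<Rightarrow> nat \<Rightarrow> nat \<times> nat \<times> nat" where
  "best u c 0 = (0, 0, 1)"
| "best u c (Suc i) =
     (if fst (snd (best u c i)) * c ! i < u i * snd (snd (best u c i)) then (i, u i, c ! i) else best u c i)"

text \<open>With \<open>L = scale n k\<close>, \<open>L ^ 4\<close> samples estimate all probabilities up to \<open>1 / L\<close>. Estimated influences below
  \<open>2 / L\<close> are ignored, and the strategy stops once one of the two values of the function has estimated
  probability below \<open>4 / k\<close>, where \<open>1 / k\<close> approximates the error parameter.\<close>

definition scale :: "nat \<Rightarrow> nat \<Rightarrow> nat" where
  "scale n k = 3 * (n + 1) * k"

text \<open>For \<open>k > 0\<close> this is 4/k of the \<open>L ^ 4\<close> samples, where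
  \<open>L = scale n k\<close>, written without division by means of L = 3(n + 1)k.\<close>

definition margin :: "nat \<Rightarrow> nat \<Rightarrow> nat" where
  "margin n k = 12 * (n + 1) * scale n k ^ 3"

text \<open>The cut-off is subtracted rather than used as a mere filter: on a good sample a positive
  score then stays at least \<open>L ^ 3\<close> below its true value \<open>L ^ 4\<close> times the
  influence.\<close>

definition score :: "(bool list \<Rightarrow> bool) \<Rightarrow> nat \<Rightarrow> nat \<Rightarrow> history \<Rightarrow> bool list \<Rightarrow> nat \<Rightarrow> nat" where
  "score g n k h r i = hits n (scale n k ^ 4) (sensitive g h i) r - 2 * scale n k ^ 3"

definition next_action :: "(bool list \<Rightarrow> bool) \<Rightarrow> nat list \<Rightarrow> nat \<Rightarrow> history \<Rightarrow> bool list \<Rightarrow> action" where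
  "next_action g c k h r =
     (let n = length c; m = scale n k ^ 4; K = hits n m (\<lambda>x. g (override h x)) r;
          b = best (score g n k h r) c n
      in if fst (snd b) = 0 \<or> K < margin n k \<or> m < K + margin n k
         then Output (if m \<le> 2 * K then 1 else -1) else Query (fst b))"

lemma override_block: "override h (block n r j) = map (\<lambda>i. hist_value h i (r ! (n * j + i))) [0..<n]"
  by (simp add: override_def block_def)

lemma hits_le: "hits n m Q r \<le> m"
  unfolding hits_def using sum_bounded_above[of "{..<m}" "\<lambda>j. of_bool (Q (block n r j))" "1 :: nat"] by simp

text \<open>Bounds the factor over which the products in \<open>best\<close> are looped: scores are
  small, costs need not be.\<close>

lemma best_le:
  assumes "\<And>i. u i \<le> m"
  shows "fst (snd (best u c i)) \<le> m"
  by (induction i) (use assms in auto)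

section \<open>The next action is computable in polynomial time\<close>

definition evaluable :: "'a set \<Rightarrow> ('a \<Rightarrow> nat) \<Rightarrow> ('a \<Rightarrow> nat) \<Rightarrow> ('a \<Rightarrow> data) \<Rightarrow> ('a \<Rightarrow> bool list \<Rightarrow> bool) \<Rightarrow> bool" where
  "evaluable A sz n w g \<longleftrightarrow> (\<exists>P (p :: nat poly). \<forall>a\<in>A. \<forall>x\<in>cube (n a).
     halts_within P (Join (w a) (enc_bits x)) (poly p (sz a)) (enc_bool (g a x)))"

lemma evaluable_Sigma:
  "evaluable A sz n w g \<Longrightarrow>
   evaluable (Sigma A B) (\<lambda>z. sz (fst z)) (\<lambda>z. n (fst z)) (\<lambda>z. w (fst z)) (\<lambda>z. g (fst z))"
  unfolding evaluable_def by fastforce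

lemma feasible_eval:
  assumes "evaluable A sz n w g" "feasible A sz inp w" "feasible A sz inp (\<lambda>a. enc_bits (x a))"
    "\<And>a. a \<in> A \<Longrightarrow> x a \<in> cube (n a)"
  shows "feasible A sz inp (\<lambda>a. enc_bool (g a (x a)))"
proof (rule feasible_trans[OF feasible_Join[OF assms(2,3)]])
  show "feasible A sz (\<lambda>a. Join (w a) (enc_bits (x a))) (\<lambda>a. enc_bool (g a (x a)))"
    using assms(1,4) unfolding evaluable_def feasible_def by fast
qed

lemma feasible_hist_value:
  assumes "feasible A sz inp (\<lambda>a. enc_history (h a))" "poly_bounded A sz (\<lambda>a. length (h a))"
    "feasible A sz inp (\<lambda>a. Atom (i a))" "feasible A sz inp (\<lambda>a. enc_bool (b a))"
  shows "feasible A sz inp (\<lambda>a. enc_bool (hist_value (h a) (i a) (b a)))"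
proof -
  let ?e = "\<lambda>(i, b). Join (Atom i) (enc_bool b)"
  define s where "s = (\<lambda>a j. enc_bool (hist_value (take j (h a)) (i a) (b a)))"
  let ?B = "Sigma A (\<lambda>a. {..<length (h a)})"
  have h: "feasible A sz inp (\<lambda>a. enc_list ?e (h a))"
    using assms(1) by (simp add: enc_history_def)
  have "feasible A sz inp (\<lambda>a. s a (length (h a)))"
  proof (rule feasible_for[OF feasible_length[OF h assms(2)] assms(2)])
    show "feasible A sz inp (\<lambda>a. s a 0)"
      using assms(4) by (simp add: s_def)
    have "feasible ?B (\<lambda>z. sz (fst z)) (loop_input inp s) (\<lambda>z. ?e (h (fst z) ! snd z))"
      by (rule feasible_nth[OF feasible_outer[OF h] feasible_counter poly_bounded_index[OF assms(2)]]) auto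
    then have e: "feasible ?B (\<lambda>z. sz (fst z)) (loop_input inp s)
        (\<lambda>z. Join (Atom (fst (h (fst z) ! snd z))) (enc_bool (snd (h (fst z) ! snd z))))"
      by (simp add: case_prod_beta)
    show "feasible ?B (\<lambda>z. sz (fst z)) (loop_input inp s) (\<lambda>z. s (fst z) (Suc (snd z)))"
    proof (rule feasible_cong[OF feasible_if_bool[OF feasible_neq[OF feasible_fst[OF e] feasible_outer[OF assms(3)]]
            feasible_state feasible_snd[OF e]]])
      fix z assume "z \<in> ?B"
      then have "snd z < length (h (fst z))" by auto
      then have t: "take (Suc (snd z)) (h (fst z))
          = take (snd z) (h (fst z)) @ [(fst (h (fst z) ! snd z), snd (h (fst z) ! snd z))]"
        by (simp add: take_Suc_conv_app_nth)
      show "(if fst (h (fst z) ! snd z) \<noteq> i (fst z) then s (fst z) (snd z) else enc_bool (snd (h (fst z) ! snd z)))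
          = s (fst z) (Suc (snd z))"
        by (simp only: s_def t hist_value_append) simp
    qed
  qed
  then show ?thesis by (simp add: s_def)
qed

lemma feasible_eval_block:
  assumes ev: "evaluable A sz n w g" "feasible A sz inp w"
    and n: "feasible A sz inp (\<lambda>a. Atom (n a))" "poly_bounded A sz n"
    and h: "feasible A sz inp (\<lambda>a. enc_history (h a))" "poly_bounded A sz (\<lambda>a. length (h a))"
    and r: "feasible A sz inp (\<lambda>a. enc_bits (r a))"
    and j: "feasible A sz inp (\<lambda>a. Atom (j a))" "poly_bounded A sz j"
    and len: "\<And>a. a \<in> A \<Longrightarrow> n a * Suc (j a) \<le> length (r a)"
  shows "feasible A sz inp (\<lambda>a. enc_bool (g a (override (h a) (block (n a) (r a) (j a)))))"
proof (rule feasible_eval[OF ev])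
  let ?B = "Sigma A (\<lambda>a. {..<n a})"
  let ?i = "\<lambda>z. n (fst z) - Suc (snd z)"
  have "feasible A sz inp (\<lambda>a. enc_list enc_bool (map (\<lambda>i. hist_value (h a) i (r a ! (n a * j a + i))) [0..<n a]))"
  proof (rule feasible_map_upt[OF n])
    fix s
    note outer = feasible_outer[where B = "\<lambda>a. {..<n a}" and s = s]
    have i: "feasible ?B (\<lambda>z. sz (fst z)) (loop_input inp s) (\<lambda>z. Atom (?i z))"
      using feasible_diff[OF outer[OF n(1)] feasible_add[OF feasible_counter feasible_const[of _ _ _ 1]]]
      by simp
    have bi: "poly_bounded ?B (\<lambda>z. sz (fst z)) ?i"
      by (rule poly_bounded_mono[OF poly_bounded_Sigma[OF n(2)]]) simp
    have "feasible ?B (\<lambda>z. sz (fst z)) (loop_input inp s)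
        (\<lambda>z. enc_bool (r (fst z) ! (n (fst z) * j (fst z) + ?i z)))"
    proof (rule feasible_nth)
      show "feasible ?B (\<lambda>z. sz (fst z)) (loop_input inp s) (\<lambda>z. enc_list enc_bool (r (fst z)))"
        using outer[OF r] by (simp add: enc_bits_def)
      show "feasible ?B (\<lambda>z. sz (fst z)) (loop_input inp s) (\<lambda>z. Atom (n (fst z) * j (fst z) + ?i z))"
        by (intro feasible_add[OF _ i] feasible_mult outer[OF n(1)] outer[OF j(1)] poly_bounded_Sigma[OF n(2)])
      show "poly_bounded ?B (\<lambda>z. sz (fst z)) (\<lambda>z. n (fst z) * j (fst z) + ?i z)"
        by (intro poly_bounded_add poly_bounded_mult poly_bounded_Sigma[OF n(2)] poly_bounded_Sigma[OF j(2)] bi)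
      fix z assume "z \<in> ?B"
      then show "n (fst z) * j (fst z) + ?i z < length (r (fst z))"
        using len[of "fst z"] by auto
    qed
    then show "feasible ?B (\<lambda>z. sz (fst z)) (loop_input inp s)
        (\<lambda>z. enc_bool (hist_value (h (fst z)) (?i z) (r (fst z) ! (n (fst z) * j (fst z) + ?i z))))"
      by (intro feasible_hist_value outer[OF h(1)] poly_bounded_Sigma[OF h(2)] i)
  qed
  then show "feasible A sz inp (\<lambda>a. enc_bits (override (h a) (block (n a) (r a) (j a))))"
    by (simp add: enc_bits_def override_block)
qed (simp add: cube_def block_def)

lemma feasible_hits:
  assumes "feasible A sz inp (\<lambda>a. Atom (m a))" "poly_bounded A sz m"
    "\<And>s. feasible (Sigma A (\<lambda>a. {..<m a})) (\<lambda>z. sz (fst z)) (loop_input inp s)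
      (\<lambda>z. enc_bool (Q (fst z) (block (n (fst z)) (r (fst z)) (snd z))))"
  shows "feasible A sz inp (\<lambda>a. Atom (hits (n a) (m a) (Q a) (r a)))"
  unfolding hits_def using assms(3) by (intro feasible_sum assms(1,2)) (simp add: enc_bool_def)

lemma feasible_enc_history_Cons:
  assumes "feasible A sz inp (\<lambda>a. Atom (i a))" "feasible A sz inp (\<lambda>a. enc_history (h a))"
  shows "feasible A sz inp (\<lambda>a. enc_history ((i a, b) # h a))"
  using feasible_Join[OF feasible_Join[OF assms(1) feasible_enc_const[of _ _ _ b]] assms(2)]
  by (simp add: enc_history_def)

lemma feasible_scale:
  assumes "feasible A sz inp (\<lambda>a. Atom (n a))" "poly_bounded A sz n"
    "feasible A sz inp (\<lambda>a. Atom (k a))" "poly_bounded A sz k"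
  shows "poly_bounded A sz (\<lambda>a. scale (n a) (k a))" "feasible A sz inp (\<lambda>a. Atom (scale (n a) (k a)))"
  unfolding scale_def
  by (intro feasible_mult feasible_add feasible_const poly_bounded_intros assms)+

lemma feasible_power:
  assumes "feasible A sz inp (\<lambda>a. Atom (x a))" "poly_bounded A sz x"
  shows "feasible A sz inp (\<lambda>a. Atom (x a ^ d))"
  by (induction d) (auto intro: feasible_mult feasible_const assms)

text \<open>The loops over coordinates, samples, bits and history entries are nested. Each level
  adds a \<open>Sigma\<close> to the domain and a layer of \<open>loop_input\<close> to the input,
  while the size remains that of the instance.\<close>

lemma feasible_next_action:
  fixes c :: "'a \<Rightarrow> nat list"
  defines "n \<equiv> \<lambda>a. length (c a)"
  assumes ev: "evaluable A sz n w g" "feasible A sz inp w"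
    and c: "feasible A sz inp (\<lambda>a. enc_list Atom (c a))" "poly_bounded A sz n"
    and k: "feasible A sz inp (\<lambda>a. Atom (k a))" "poly_bounded A sz k"
    and h: "feasible A sz inp (\<lambda>a. enc_history (h a))" "poly_bounded A sz (\<lambda>a. length (h a))"
    and r: "feasible A sz inp (\<lambda>a. enc_bits (r a))"
    and len: "\<And>a. a \<in> A \<Longrightarrow> n a * scale (n a) (k a) ^ 4 \<le> length (r a)"
  shows "feasible A sz inp (\<lambda>a. enc_action (next_action (g a) (c a) (k a) (h a) (r a)))"
proof -
  let ?m = "\<lambda>a. scale (n a) (k a) ^ 4"
  define u where "u = (\<lambda>a. score (g a) (n a) (k a) (h a) (r a))"
  have n: "feasible A sz inp (\<lambda>a. Atom (n a))"
    unfolding n_def by (rule feasible_length[OF c(1)]) (use c(2) in \<open>simp add: n_def\<close>)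
  note L = feasible_scale[OF n c(2) k]
  have m: "feasible A sz inp (\<lambda>a. Atom (?m a))" "poly_bounded A sz ?m"
    by (intro feasible_power poly_bounded_power L)+
  have j_len: "n (fst z) * Suc (snd z) \<le> length (r (fst z))" if "z \<in> Sigma A (\<lambda>a. {..<?m a})" for z
  proof -
    have "n (fst z) * Suc (snd z) \<le> n (fst z) * ?m (fst z)"
      using that by (intro mult_le_mono2) auto
    then show ?thesis using len[of "fst z"] that by auto
  qed
  have K: "feasible A sz inp (\<lambda>a. Atom (hits (n a) (?m a) (\<lambda>x. g a (override (h a) x)) (r a)))"
  proof (rule feasible_hits[OF m])
    fix s
    note outer = feasible_outer[where B = "\<lambda>a. {..<?m a}" and s = s]
    show "feasible (Sigma A (\<lambda>a. {..<?m a})) (\<lambda>z. sz (fst z)) (loop_input inp s)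
      (\<lambda>z. enc_bool (g (fst z) (override (h (fst z)) (block (n (fst z)) (r (fst z)) (snd z)))))"
      by (rule feasible_eval_block[OF evaluable_Sigma[OF ev(1)] outer[OF ev(2)] outer[OF n] poly_bounded_Sigma[OF c(2)]
            outer[OF h(1)] poly_bounded_Sigma[OF h(2)] outer[OF r] feasible_counter poly_bounded_index[OF m(2)] j_len])
  qed
  let ?B = "Sigma A (\<lambda>a. {..<n a})"
  have score: "feasible ?B (\<lambda>z. sz (fst z)) (loop_input inp s) (\<lambda>z. Atom (u (fst z) (snd z)))" for s
  proof -
    note outer = feasible_outer[where B = "\<lambda>a. {..<n a}" and s = s]
    have "feasible ?B (\<lambda>z. sz (fst z)) (loop_input inp s)
        (\<lambda>z. Atom (hits (n (fst z)) (?m (fst z)) (sensitive (g (fst z)) (h (fst z)) (snd z)) (r (fst z))))"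
    proof (rule feasible_hits[OF outer[OF m(1)] poly_bounded_Sigma[OF m(2)]])
      fix s'
      note outer' = feasible_outer[where B = "\<lambda>z. {..<?m (fst z)}" and s = s']
      have hc: "poly_bounded (Sigma ?B (\<lambda>z. {..<?m (fst z)})) (\<lambda>y. sz (fst (fst y)))
          (\<lambda>y. length ((snd (fst y), b) # h (fst (fst y))))" for b
        using poly_bounded_add[OF poly_bounded_Sigma[OF poly_bounded_Sigma[OF h(2)]] poly_bounded_const[of _ _ 1]]
        by simp
      have "feasible (Sigma ?B (\<lambda>z. {..<?m (fst z)})) (\<lambda>y. sz (fst (fst y))) (loop_input (loop_input inp s) s')
          (\<lambda>y. enc_bool (g (fst (fst y)) (override ((snd (fst y), b) # h (fst (fst y)))
            (block (n (fst (fst y))) (r (fst (fst y))) (snd y)))))" for b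
      proof (rule feasible_eval_block[OF evaluable_Sigma[OF evaluable_Sigma[OF ev(1)]] outer'[OF outer[OF ev(2)]]
            outer'[OF outer[OF n]] poly_bounded_Sigma[OF poly_bounded_Sigma[OF c(2)]]
            feasible_enc_history_Cons[OF outer'[OF feasible_counter] outer'[OF outer[OF h(1)]]] hc
            outer'[OF outer[OF r]] feasible_counter poly_bounded_index[OF poly_bounded_Sigma[OF m(2)]]])
        fix y assume "y \<in> Sigma ?B (\<lambda>z. {..<?m (fst z)})"
        then show "n (fst (fst y)) * Suc (snd y) \<le> length (r (fst (fst y)))"
          using j_len[of "(fst (fst y), snd y)"] by auto
      qed
      then show "feasible (Sigma ?B (\<lambda>z. {..<?m (fst z)})) (\<lambda>y. sz (fst (fst y))) (loop_input (loop_input inp s) s')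
          (\<lambda>y. enc_bool (sensitive (g (fst (fst y))) (h (fst (fst y))) (snd (fst y))
            (block (n (fst (fst y))) (r (fst (fst y))) (snd y))))"
        by (intro feasible_neq_bool)
    qed
    then show ?thesis
      unfolding u_def score_def
      by (intro feasible_diff feasible_mult[OF feasible_const poly_bounded_const] feasible_power
          outer[OF L(2)] poly_bounded_Sigma[OF L(1)])
  qed
  let ?enc = "\<lambda>b. Join (Atom (fst b)) (Join (Atom (fst (snd b))) (Atom (snd (snd b))))"
  define s where "s = (\<lambda>a i. ?enc (best (u a) (c a) i))"
  note outer = feasible_outer[where B = "\<lambda>a. {..<n a}" and s = s]
  have u_le: "u a i \<le> ?m a" for a i
    unfolding u_def score_def using hits_le[of "n a" "?m a"] by (meson diff_le_self order_trans)
  have best: "feasible A sz inp (\<lambda>a. s a (n a))"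
  proof (rule feasible_for[OF n c(2)])
    show "feasible A sz inp (\<lambda>a. s a 0)"
      unfolding s_def by (simp, intro feasible_Join feasible_const)
    have st: "feasible ?B (\<lambda>z. sz (fst z)) (loop_input inp s) (\<lambda>z. ?enc (best (u (fst z)) (c (fst z)) (snd z)))"
      using feasible_state[of A _ sz s inp] by (simp add: s_def)
    have ci: "feasible ?B (\<lambda>z. sz (fst z)) (loop_input inp s) (\<lambda>z. Atom (c (fst z) ! snd z))"
      by (rule feasible_nth[OF outer[OF c(1)] feasible_counter poly_bounded_index[OF c(2)]]) (auto simp: n_def)
    have bu: "poly_bounded ?B (\<lambda>z. sz (fst z)) (\<lambda>z. fst (snd (best (u (fst z)) (c (fst z)) (snd z))))"
      "poly_bounded ?B (\<lambda>z. sz (fst z)) (\<lambda>z. u (fst z) (snd z))"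
      by (rule poly_bounded_mono[OF poly_bounded_Sigma[OF m(2)]], use u_le best_le in blast)+
    have "feasible ?B (\<lambda>z. sz (fst z)) (loop_input inp s) (\<lambda>z.
        if fst (snd (best (u (fst z)) (c (fst z)) (snd z))) * c (fst z) ! snd z
            < u (fst z) (snd z) * snd (snd (best (u (fst z)) (c (fst z)) (snd z)))
        then Join (Atom (snd z)) (Join (Atom (u (fst z) (snd z))) (Atom (c (fst z) ! snd z)))
        else s (fst z) (snd z))"
      by (intro feasible_if_bool feasible_less feasible_mult bu feasible_fst[OF feasible_snd[OF st]]
          feasible_snd[OF feasible_snd[OF st]] ci score feasible_Join feasible_counter feasible_state)
    then show "feasible ?B (\<lambda>z. sz (fst z)) (loop_input inp s) (\<lambda>z. s (fst z) (Suc (snd z)))"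
      by (rule feasible_cong) (simp add: s_def)
  qed
  let ?K = "\<lambda>a. hits (n a) (?m a) (\<lambda>x. g a (override (h a) x)) (r a)"
  let ?stop = "\<lambda>a. fst (snd (best (u a) (c a) (n a))) = 0 \<or> ?K a < margin (n a) (k a) \<or> ?m a < ?K a + margin (n a) (k a)"
  have margin: "feasible A sz inp (\<lambda>a. Atom (margin (n a) (k a)))"
    unfolding margin_def
    by (intro feasible_mult feasible_add feasible_const poly_bounded_intros feasible_power n c(2) L)
  have bst: "feasible A sz inp (\<lambda>a. ?enc (best (u a) (c a) (n a)))"
    using best by (simp add: s_def)
  have "feasible A sz inp (\<lambda>a. enc_bool (\<not> fst (snd (best (u a) (c a) (n a))) \<noteq> 0))"
    by (intro feasible_not feasible_nonzero feasible_fst[OF feasible_snd[OF bst]])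
  then have stop: "feasible A sz inp (\<lambda>a. enc_bool (?stop a))"
    by (intro feasible_or feasible_less K margin feasible_add m(1)) simp
  have "feasible A sz inp (\<lambda>a. enc_bool (\<not> ?K a + ?K a < ?m a))"
    by (intro feasible_not feasible_less feasible_add K m(1))
  then have "feasible A sz inp (\<lambda>a. if ?stop a then Join (Atom 1) (enc_bool (\<not> ?K a + ?K a < ?m a))
      else Join (Atom 0) (Atom (fst (best (u a) (c a) (n a)))))"
    by (intro feasible_if_bool stop feasible_Join feasible_const feasible_fst[OF bst])
  then show ?thesis
    by (rule feasible_cong)
       (auto simp: next_action_def n_def u_def Let_def enc_sign_def enc_bool_def not_less mult_2)
qed

section \<open>Sampling\<close>

lemma block_cube [simp]: "block n r j \<in> cube n"
  by (simp add: block_def cube_def)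

lemma block_append:
  assumes "y \<in> cube n"
  shows "block n (y @ r) 0 = y" "block n (y @ r) (Suc j) = block n r j"
  using assms by (auto simp: block_def cube_def nth_append list_eq_iff_nth_eq add.assoc)

lemma hits_Suc: "y \<in> cube n \<Longrightarrow> hits n (Suc m) Q (y @ r) = of_bool (Q y) + hits n m Q r"
  by (simp add: hits_def sum.lessThan_Suc_shift block_append del: sum.lessThan_Suc)

text \<open>Splitting off the first block writes the deviation as a sum of two independent terms of
  mean zero, so the cross term vanishes and the variances add. The random string may be longer than
  the samples require.\<close>

lemma hits_moments:
  fixes p :: real and Q :: "bool list \<Rightarrow> bool"
  assumes "n * m \<le> B"
  defines "p \<equiv> avg n (\<lambda>x. of_bool (Q x))"
  shows "avg B (\<lambda>r. hits n m Q r - m * p) = 0 \<and> avg B (\<lambda>r. (hits n m Q r - m * p)\<^sup>2) = m * (p * (1 - p))"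
  using assms(1)
proof (induction m arbitrary: B)
  case 0
  then show ?case by (simp add: hits_def)
next
  case (Suc m)
  define B' where "B' = B - n"
  have B: "B = n + B'" "n * m \<le> B'" using Suc.prems by (auto simp: B'_def)
  define X where "X = (\<lambda>y. of_bool (Q y) - p)"
  define Z where "Z = (\<lambda>r. real (hits n m Q r) - m * p)"
  have Z: "avg B' Z = 0" "avg B' (\<lambda>r. (Z r)\<^sup>2) = m * (p * (1 - p))"
    using Suc.IH[OF B(2)] by (simp_all add: Z_def)
  have X: "avg n X = 0"
    by (simp add: X_def p_def avg_diff)
  have "(X y)\<^sup>2 = (1 - 2 * p) * X y + p * (1 - p)" for y
    by (simp add: X_def power2_eq_square algebra_simps)
  then have X2: "avg n (\<lambda>y. (X y)\<^sup>2) = p * (1 - p)"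
    by (simp add: avg_add avg_mult X)
  have sum: "real (hits n (Suc m) Q (y @ r)) - Suc m * p = X y + Z r" if "y \<in> cube n" for y r
    by (simp add: hits_Suc[OF that] X_def Z_def algebra_simps)
  have "avg B (\<lambda>r. hits n (Suc m) Q r - Suc m * p) = avg n (\<lambda>y. avg B' (\<lambda>r. X y + Z r))"
    unfolding B(1) avg_append by (intro avg_cong) (simp only: sum)
  also have "\<dots> = 0"
    by (simp add: avg_add Z X)
  finally have 1: "avg B (\<lambda>r. hits n (Suc m) Q r - Suc m * p) = 0" .
  have "avg B (\<lambda>r. (hits n (Suc m) Q r - Suc m * p)\<^sup>2)
      = avg n (\<lambda>y. avg B' (\<lambda>r. (X y)\<^sup>2 + 2 * X y * Z r + (Z r)\<^sup>2))"
    unfolding B(1) avg_append by (intro avg_cong) (subst sum, assumption, simp add: power2_sum)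
  also have "\<dots> = Suc m * (p * (1 - p))"
  proof -
    have "avg B' (\<lambda>r. (X y)\<^sup>2 + 2 * X y * Z r + (Z r)\<^sup>2) = (X y)\<^sup>2 + m * (p * (1 - p))" for y
      by (simp add: avg_add avg_mult Z)
    then have "avg n (\<lambda>y. avg B' (\<lambda>r. (X y)\<^sup>2 + 2 * X y * Z r + (Z r)\<^sup>2)) = avg n (\<lambda>y. (X y)\<^sup>2 + m * (p * (1 - p)))"
      by (simp only:)
    then show ?thesis
      by (simp only: avg_add X2 avg_const) (simp add: distrib_right)
  qed
  finally show ?case using 1 by blast
qed

text \<open>The factor \<open>p * (1 - p)\<close> is kept, since for almost constant restrictions
  the failure probability has to shrink with the variance.\<close>

lemma hits_Chebyshev:
  fixes p t :: real and Q :: "bool list \<Rightarrow> bool"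
  assumes "n * m \<le> B" "0 < t"
  defines "p \<equiv> avg n (\<lambda>x. of_bool (Q x))"
  shows "avg B (\<lambda>r. of_bool (t < \<bar>hits n m Q r - m * p\<bar>)) \<le> m * (p * (1 - p)) / t\<^sup>2"
proof -
  have "avg B (\<lambda>r. of_bool (t < \<bar>hits n m Q r - m * p\<bar>)) \<le> avg B (\<lambda>r. (hits n m Q r - m * p)\<^sup>2 / t\<^sup>2)"
  proof (rule avg_mono)
    fix r
    show "of_bool (t < \<bar>hits n m Q r - m * p\<bar>) \<le> (hits n m Q r - m * p)\<^sup>2 / t\<^sup>2"
    proof (cases "t < \<bar>hits n m Q r - m * p\<bar>")
      case True
      then have "t\<^sup>2 \<le> (hits n m Q r - m * p)\<^sup>2"
        using \<open>0 < t\<close> by (metis abs_le_square_iff abs_of_pos less_imp_le)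
      then show ?thesis using \<open>0 < t\<close> by simp
    qed simp
  qed
  also have "\<dots> = m * (p * (1 - p)) / t\<^sup>2"
    using hits_moments[OF assms(1), of Q] by (simp add: avg_divide p_def)
  finally show ?thesis .
qed

text \<open>Comparing by cross-multiplication admits coordinates of cost 0: with a positive score
  they beat every coordinate of positive cost.\<close>

lemma best_spec:
  "(\<forall>j<i. u j * snd (snd (best u c i)) \<le> fst (snd (best u c i)) * c ! j) \<and>
   (fst (snd (best u c i)) \<noteq> 0 \<longrightarrow> fst (best u c i) < i \<and> fst (snd (best u c i)) = u (fst (best u c i)) \<and>
      snd (snd (best u c i)) = c ! fst (best u c i)) \<and>
   (fst (snd (best u c i)) = 0 \<longrightarrow> snd (snd (best u c i)) = 1)"
proof (induction i)
  case (Suc i)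
  obtain b a v where b: "best u c i = (b, a, v)" by (cases "best u c i")
  have IH: "\<And>j. j < i \<Longrightarrow> u j * v \<le> a * c ! j" "a \<noteq> 0 \<Longrightarrow> b < i \<and> a = u b \<and> v = c ! b" "a = 0 \<Longrightarrow> v = 1"
    using Suc b by auto
  show ?case
  proof (cases "a * c ! i < u i * v")
    case True
    \<comment> \<open>Transitivity of the cross-multiplied comparison. The cost \<open>v\<close> may
      be 0, so \<open>a\<close> is cancelled instead; \<open>a = 0\<close> forces
      \<open>v = 1\<close>, whence \<open>u j = 0\<close>.\<close>
    have "u j * c ! i \<le> u i * c ! j" if "j < i" for j
    proof (cases "a = 0")
      case False
      have "a * (u j * c ! i) \<le> u j * (u i * v)"
        using mult_left_mono[OF less_imp_le[OF True], of "u j"] by (simp add: ac_simps)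
      also have "\<dots> \<le> a * (u i * c ! j)"
        using mult_left_mono[OF IH(1)[OF that], of "u i"] by (simp add: ac_simps)
      finally show ?thesis using False by simp
    qed (use IH(1)[OF that] IH(3) in simp)
    then show ?thesis using True b by (auto simp: less_Suc_eq)
  next
    case False
    then show ?thesis using b IH by (auto simp: less_Suc_eq)
  qed
qed simp


section \<open>Analysis of one step\<close>

locale query_instance =
  fixes n :: nat and f :: "bool list \<Rightarrow> int" and c :: "nat list" and \<epsilon> :: real and k B :: nat
  assumes f: "f \<in> cube n \<rightarrow> {-1, 1}" and len_c: "length c = n"
    and eps: "0 < \<epsilon>" "\<epsilon> < 1 / 2" and k: "k = nat \<lceil>1 / \<epsilon>\<rceil>"
    and B: "n * scale n k ^ 4 \<le> B"
begin

abbreviation "L \<equiv> scale n k"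
abbreviation "opt \<equiv> opt_worst n f c 0"
abbreviation "act \<equiv> next_action (\<lambda>x. f x = 1) c k"

definition p :: "history \<Rightarrow> real" where
  "p h = avg n (\<lambda>x. of_bool (f (override h x) = 1))"

definition J :: "history \<Rightarrow> nat \<Rightarrow> real" where
  "J h i = infl n (\<lambda>x. f (override h x)) i"

definition total :: "history \<Rightarrow> real" where
  "total h = (\<Sum>i<n. J h i)"

abbreviation positives :: "history \<Rightarrow> bool list \<Rightarrow> nat" where
  "positives h r \<equiv> hits n (L ^ 4) (\<lambda>x. f (override h x) = 1) r"

abbreviation flips :: "history \<Rightarrow> bool list \<Rightarrow> nat \<Rightarrow> nat" where
  "flips h r i \<equiv> hits n (L ^ 4) (sensitive (\<lambda>x. f x = 1) h i) r"

text \<open>Kept apart from \<open>good\<close> because it alone makes the strategy stop on almost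
  constant restrictions, and its failure probability carries the factor
  \<open>p h * (1 - p h)\<close>.\<close>

definition good_mean :: "history \<Rightarrow> bool list \<Rightarrow> bool" where
  "good_mean h r \<longleftrightarrow> \<bar>real (positives h r) - L ^ 4 * p h\<bar> \<le> L ^ 3"

definition good :: "history \<Rightarrow> bool list \<Rightarrow> bool" where
  "good h r \<longleftrightarrow> good_mean h r \<and> (\<forall>i<n. \<bar>real (flips h r i) - L ^ 4 * J h i\<bar> \<le> L ^ 3)"

text \<open>Rounding up gives 1 \<le> \<epsilon> k < 1 + \<epsilon>, and \<epsilon> < 1/2.\<close>

lemma k_bounds: "1 \<le> \<epsilon> * k" "2 * \<epsilon> * k \<le> 3" "0 < k"
proof -
  have "0 < 1 / \<epsilon>" using eps by simp
  then have k': "real k = of_int \<lceil>1 / \<epsilon>\<rceil>"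
    unfolding k by simp
  then have "1 / \<epsilon> \<le> k" "k < 1 / \<epsilon> + 1" by linarith+
  then show "1 \<le> \<epsilon> * k" "2 * \<epsilon> * k \<le> 3"
    using eps by (simp_all add: field_simps)
  then show "0 < k" by (cases k) auto
qed

lemma inv_k_le: "1 / k \<le> \<epsilon>"
  using k_bounds by (simp add: field_simps)

lemma L_pos: "0 < L"
  using k_bounds by (simp add: scale_def)

definition N :: real where
  "N = real n + 1"

lemma N_ge: "1 \<le> N" "0 < N" "real n \<le> N"
  by (simp_all add: N_def)

lemma L_eq: "real L = 3 * N * k"
  by (simp add: scale_def N_def)

lemma margin_eq: "real (margin n k) = 12 * N * real L ^ 3"
  by (simp add: margin_def N_def algebra_simps)

lemma inv_L_le: "1 / L \<le> 1 / k" "3 / L * n \<le> 1 / k"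
  using k_bounds(3) N_ge by (simp_all add: L_eq field_simps)

lemma fh_range: "(\<lambda>x. f (override h x)) \<in> cube n \<rightarrow> {-1, 1}"
  using f by auto

lemma p_bounds: "0 \<le> p h" "p h \<le> 1"
  unfolding p_def by (auto intro: avg_nonneg avg_le_const)

lemma J_nonneg: "0 \<le> J h i"
  by (simp add: J_def infl_nonneg)

lemma total_nonneg: "0 \<le> total h"
  unfolding total_def by (simp add: sum_nonneg J_nonneg)

lemma sensitive_iff:
  assumes "x \<in> cube n"
  shows "sensitive (\<lambda>x. f x = 1) h i x \<longleftrightarrow> f (override h (x[i := True])) \<noteq> f (override h (x[i := False]))"
proof -
  have "f (override h (x[i := b])) \<in> {-1, 1}" for b
    using f assms by auto
  from this[of True] this[of False] show ?thesis
    by (auto simp: override_Cons)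
qed

lemma J_eq: "J h i = avg n (\<lambda>x. of_bool (sensitive (\<lambda>x. f x = 1) h i x))"
  unfolding J_def infl_def by (rule avg_cong) (simp only: sensitive_iff)

lemma tree_h:
  obtains t where "read_once t" "tree_vars t \<subseteq> {..<n}"
    "\<And>x. x \<in> cube n \<Longrightarrow> tree_eval t x = f (override h x)" "tree_cost c t \<le> opt"
  using opt_worst_restricted[OF f len_c] by metis

text \<open>Used by contradiction, to find a coordinate of large ratio that sampling can see, and
  with \<open>\<mu> = 0\<close>, to bound the variance when no influence is visible.\<close>

lemma OSSS:
  assumes "\<And>i. i < n \<Longrightarrow> J h i \<le> \<mu> * real (c ! i) + \<tau>" "0 \<le> \<mu>" "0 \<le> \<tau>"
  shows "4 * (p h * (1 - p h)) \<le> \<mu> * opt + \<tau> * n"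
proof -
  obtain t where t: "read_once t" "tree_vars t \<subseteq> {..<n}"
    "\<And>x. x \<in> cube n \<Longrightarrow> tree_eval t x = f (override h x)" "tree_cost c t \<le> opt"
    using tree_h[of h] by blast
  have "4 * (p h * (1 - p h)) \<le> path_avg (J h) t"
    unfolding p_def J_def[abs_def] by (rule variance_le_path_avg[OF t(1-3) fh_range])
  also have "\<dots> \<le> \<mu> * tree_cost c t + \<tau> * card {..<n}"
    using t assms by (intro path_avg_le) auto
  also have "\<dots> \<le> \<mu> * opt + \<tau> * n"
    using t(4) assms(2) by (simp add: mult_left_mono)
  finally show ?thesis .
qed

lemma Poincare: "4 * (p h * (1 - p h)) \<le> total h"
proof -
  obtain t where t: "read_once t" "tree_vars t \<subseteq> {..<n}"
    "\<And>x. x \<in> cube n \<Longrightarrow> tree_eval t x = f (override h x)" "tree_cost c t \<le> opt"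
    using tree_h[of h] by blast
  have "4 * (p h * (1 - p h)) \<le> path_avg (J h) t"
    unfolding p_def J_def[abs_def] by (rule variance_le_path_avg[OF t(1-3) fh_range])
  also have "\<dots> \<le> total h"
    unfolding total_def using t by (intro path_avg_le_sum J_nonneg) auto
  finally show ?thesis .
qed

text \<open>Holds for every \<open>r\<close>, good or bad: a positive score means that some sample
  actually exhibited sensitivity, and a sensitive coordinate lies on a path of the optimal tree of
  the restriction.\<close>

lemma query_legal:
  assumes "act h r = Query i"
  shows "i < n" "i \<notin> fst ` set h" "c ! i \<le> opt"
proof -
  define u where "u = score (\<lambda>x. f x = 1) n k h r"
  have a: "fst (snd (best u c n)) \<noteq> 0" "i = fst (best u c n)"
    using assms by (auto simp: next_action_def Let_def len_c u_def split: if_splits)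
  then have "i < n" "u i \<noteq> 0" using best_spec[of n u c] by auto
  then have "flips h r i \<noteq> 0"
    by (auto simp: u_def score_def)
  then obtain j where "sensitive (\<lambda>x. f x = 1) h i (block n r j)"
    by (auto simp: hits_def)
  then obtain x where x: "x \<in> cube n" "f (override h (x[i := True])) \<noteq> f (override h (x[i := False]))"
    using sensitive_iff[OF block_cube] block_cube by blast
  show "i < n" by fact
  show "i \<notin> fst ` set h"
    using x by (metis override_update_known)
  obtain t where t: "read_once t" "tree_vars t \<subseteq> {..<n}"
    "\<And>x. x \<in> cube n \<Longrightarrow> tree_eval t x = f (override h x)" "tree_cost c t \<le> opt"
    using tree_h[of h] by blast
  have "c ! i \<le> tree_cost c t"
    by (rule relevant_cost_le[of _ x]) (use x t in simp)
  then show "c ! i \<le> opt" using t by simp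
qed

text \<open>Tolerance \<open>L ^ 3\<close> among \<open>L ^ 4\<close> samples: Chebyshev gives L^4
  q(1-q) / L^6.\<close>

lemma hits_deviation:
  fixes q :: real
  assumes "q = avg n (\<lambda>x. of_bool (Q x))"
  shows "avg B (\<lambda>r. of_bool (\<not> \<bar>real (hits n (L ^ 4) Q r) - L ^ 4 * q\<bar> \<le> L ^ 3)) \<le> q * (1 - q) / L\<^sup>2"
proof -
  have "avg B (\<lambda>r. of_bool (real L ^ 3 < \<bar>real (hits n (L ^ 4) Q r) - real (L ^ 4) * q\<bar>))
      \<le> real (L ^ 4) * (q * (1 - q)) / (real L ^ 3)\<^sup>2"
    unfolding assms by (rule hits_Chebyshev[OF B]) (use L_pos in simp)
  also have "\<dots> = q * (1 - q) / L\<^sup>2"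
    using L_pos by (simp add: field_simps power_numeral_reduce)
  finally show ?thesis by (simp add: not_le)
qed

lemma prob_bad_mean: "avg B (\<lambda>r. of_bool (\<not> good_mean h r)) \<le> p h * (1 - p h) / L\<^sup>2"
  unfolding good_mean_def by (rule hits_deviation[OF p_def])

text \<open>Union bound over the mean and the \<open>n\<close> influences, each estimate failing
  with probability at most 1/(4 L^2).\<close>

definition \<eta> :: real where
  "\<eta> = N / (4 * L\<^sup>2)"

lemma prob_bad: "avg B (\<lambda>r. of_bool (\<not> good h r)) \<le> \<eta>"
proof -
  have quarter: "q * (1 - q) / L\<^sup>2 \<le> 1 / (4 * L\<^sup>2)" for q :: real
  proof -
    have "q * (1 - q) \<le> 1 / 4"
      using zero_le_power2[of "q - 1 / 2"] by (simp add: power2_eq_square algebra_simps)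
    then have "q * (1 - q) / L\<^sup>2 \<le> (1 / 4) / L\<^sup>2" by (rule divide_right_mono) simp
    then show ?thesis by simp
  qed
  define bad where "bad i r \<longleftrightarrow> \<not> \<bar>real (flips h r i) - L ^ 4 * J h i\<bar> \<le> L ^ 3" for i r
  have "avg B (\<lambda>r. of_bool (\<not> good h r))
      \<le> avg B (\<lambda>r. of_bool (\<not> good_mean h r) + (\<Sum>i<n. of_bool (bad i r)))"
  proof (rule avg_mono)
    fix r
    have good: "good h r \<longleftrightarrow> good_mean h r \<and> (\<forall>i<n. \<not> bad i r)"
      by (simp add: good_def bad_def)
    show "of_bool (\<not> good h r) \<le> of_bool (\<not> good_mean h r) + (\<Sum>i<n. of_bool (bad i r) :: real)"
    proof (cases "\<exists>i<n. bad i r")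
      case True
      then obtain i where i: "i < n" "bad i r" by blast
      have "of_bool (bad i r) \<le> (\<Sum>i<n. of_bool (bad i r) :: real)"
        using i(1) by (intro member_le_sum) auto
      then have "1 \<le> (\<Sum>i<n. of_bool (bad i r) :: real)"
        using i(2) by simp
      then show ?thesis by (simp add: of_bool_def)
    next
      case False
      then show ?thesis by (simp add: good sum_nonneg)
    qed
  qed
  also have "\<dots> \<le> 1 / (4 * L\<^sup>2) + (\<Sum>i<n. 1 / (4 * L\<^sup>2))"
    unfolding avg_add avg_sum bad_def
    by (intro add_mono sum_mono order_trans[OF prob_bad_mean quarter]
        order_trans[OF hits_deviation[OF J_eq] quarter])
  also have "\<dots> = \<eta>"
    by (simp add: \<eta>_def N_def add_divide_distrib)
  finally show ?thesis .
qed

lemma L_ge: "3 \<le> L"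
proof -
  have "1 \<le> (n + 1) * k" using k_bounds(3) by simp
  then have "3 * 1 \<le> 3 * ((n + 1) * k)" by (rule mult_le_mono2)
  then show ?thesis by (simp only: scale_def mult.assoc mult_1_right)
qed

lemma \<eta>_eq: "\<eta> = 1 / (12 * (k * L))"
proof -
  have L2: "real (4 * L\<^sup>2) = 12 * (N * (k * L))" by (simp add: power2_eq_square L_eq)
  show ?thesis
    using N_ge(2) unfolding \<eta>_def L2 by (simp add: mult.assoc)
qed

text \<open>The second bound lets bad samples be paid for by the gain of good ones; the third adds
  up the failures of at most \<open>n + 1\<close> actions.\<close>

lemma \<eta>_bounds: "0 \<le> \<eta>" "\<eta> \<le> (1 - \<eta>) / L" "N * \<eta> \<le> \<epsilon>"
proof -
  show "0 \<le> \<eta>" using N_ge by (simp add: \<eta>_def)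
  have k1: "1 \<le> real k" using k_bounds(3) by simp
  have "1 \<le> real k * L" using k1 L_ge by (metis mult_mono' of_nat_1 of_nat_le_iff order_trans one_le_numeral mult_1 zero_le_one)
  then have "\<eta> \<le> 1 / 12"
    by (simp add: \<eta>_eq field_simps)
  then have "(1 / 2) / L \<le> (1 - \<eta>) / L" by (intro divide_right_mono) auto
  moreover have "\<eta> \<le> (1 / 2) / L"
    using k1 L_pos by (simp add: \<eta>_eq field_simps)
  ultimately show "\<eta> \<le> (1 - \<eta>) / L" by linarith
  have "N * \<eta> = 1 / (36 * (k * k))"
    using N_ge k_bounds(3) by (simp add: \<eta>_eq L_eq field_simps)
  also have "\<dots> \<le> 1 / k"
    using k1 by (simp add: field_simps)
  also have "\<dots> \<le> \<epsilon>" by (rule inv_k_le)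
  finally show "N * \<eta> \<le> \<epsilon>" .
qed

lemma action_cases:
  obtains i where "act h r = Query i" "margin n k \<le> positives h r" "positives h r + margin n k \<le> L ^ 4"
    "score (\<lambda>x. f x = 1) n k h r i \<noteq> 0" "i < n"
    "\<And>j. j < n \<Longrightarrow> score (\<lambda>x. f x = 1) n k h r j * c ! i \<le> score (\<lambda>x. f x = 1) n k h r i * c ! j"
  | y where "act h r = Output y" "y = (if L ^ 4 \<le> 2 * positives h r then 1 else -1)"
    "positives h r < margin n k \<or> L ^ 4 < positives h r + margin n k \<or>
     (\<forall>j<n. score (\<lambda>x. f x = 1) n k h r j = 0)"
proof -
  define u where "u = score (\<lambda>x. f x = 1) n k h r"
  show ?thesis
  proof (cases "fst (snd (best u c n)) = 0 \<or> positives h r < margin n k \<or> L ^ 4 < positives h r + margin n k")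
    case True
    have "\<forall>j<n. u j = 0" if "fst (snd (best u c n)) = 0"
      using best_spec[of n u c] that by auto
    then show ?thesis
      using True that(2)[of "if L ^ 4 \<le> 2 * positives h r then 1 else -1"]
      by (auto simp: next_action_def Let_def len_c u_def)
  next
    case False
    then show ?thesis
      using best_spec[of n u c] that(1)[of "fst (best u c n)"]
      by (auto simp: next_action_def Let_def len_c u_def)
  qed
qed

text \<open>Both values have estimated probability at least 4/k, hence true probability at least
  3/k; the larger of the two is at least 1/2.\<close>

lemma query_mean:
  assumes "good_mean h r" "act h r = Query i"
  shows "6 / k \<le> 4 * (p h * (1 - p h))"
proof -
  define T where "T = real L ^ 3"
  have T: "0 < T" using L_pos by (simp add: T_def)
  have "margin n k \<le> positives h r" "positives h r + margin n k \<le> L ^ 4"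
    using assms(2) by (cases rule: action_cases[of h r]; simp)+
  then have "real (margin n k) \<le> positives h r" "positives h r + real (margin n k) \<le> real (L ^ 4)"
    by (simp_all only: of_nat_add[symmetric] of_nat_le_iff)
  then have K: "12 * N * T \<le> positives h r" "positives h r + 12 * N * T \<le> L * T"
    by (simp_all add: margin_eq T_def power_numeral_reduce)
  have g: "\<bar>real (positives h r) - (L * p h) * T\<bar> \<le> T"
    using assms(1) by (simp add: good_mean_def T_def power_numeral_reduce mult_ac)
  have "1 * T \<le> N * T" using N_ge T by (intro mult_right_mono) auto
  \<comment> \<open>After the sampling error at least 11 N remains; 9 N is the weaker value that
    becomes 3/k on division by L = 3 N k.\<close>
  then have "(9 * N) * T \<le> (L * p h) * T" "(9 * N) * T \<le> (L * (1 - p h)) * T"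
    using K g by (simp_all add: algebra_simps abs_le_iff)
  then have "9 * N \<le> L * p h" "9 * N \<le> L * (1 - p h)"
    using T by (simp_all only: mult_le_cancel_right_pos)
  then have "(3 * N) * 3 \<le> (3 * N) * (k * p h)" "(3 * N) * 3 \<le> (3 * N) * (k * (1 - p h))"
    by (simp_all add: L_eq mult_ac)
  then have "3 \<le> k * p h" "3 \<le> k * (1 - p h)"
    using mult_le_cancel_left_pos[of "3 * N"] N_ge(2) by (metis zero_less_mult_iff zero_less_numeral)+
  then have "3 / k \<le> p h" "3 / k \<le> 1 - p h"
    using k_bounds(3) by (simp_all add: field_simps)
  then have "3 / k * (1 / 2) \<le> p h * (1 - p h)"
  proof (cases "p h \<le> 1 / 2")
    case True
    with \<open>3 / k \<le> p h\<close> p_bounds[of h] show ?thesis by (intro mult_mono) simp_all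
  next
    case False
    with \<open>3 / k \<le> 1 - p h\<close> p_bounds[of h] have "3 / k * (1 / 2) \<le> (1 - p h) * p h" by (intro mult_mono) simp_all
    then show ?thesis by (simp add: mult.commute)
  qed
  then show ?thesis by simp
qed

text \<open>OSSS supplies a coordinate \<open>j\<close> with ratio above 2\<epsilon>/opt whose
  influence is visible, and the winner \<open>i\<close> of \<open>best\<close> has a score ratio at
  least as large. The factor 2 is the reserve for bad samples. If \<open>opt = 0\<close>, every
  coordinate that can be queried is free.\<close>

lemma query_good:
  assumes "good h r" "act h r = Query i"
  shows "2 * \<epsilon> * c ! i \<le> opt * J h i" "1 / L \<le> J h i"
proof -
  define T where "T = real L ^ 3"
  have T: "0 < T" using L_pos by (simp add: T_def)
  define u where "u = score (\<lambda>x. f x = 1) n k h r"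
  have i: "u i \<noteq> 0" "i < n" "\<And>j. j < n \<Longrightarrow> u j * c ! i \<le> u i * c ! j"
    using assms(2) by (cases rule: action_cases[of h r]; simp add: u_def)+
  have J: "\<bar>real (flips h r j) - L * T * J h j\<bar> \<le> T" if "j < n" for j
    using assms(1) that by (simp add: good_def T_def power_numeral_reduce)
  have u: "u j = flips h r j - 2 * L ^ 3" for j by (simp add: u_def score_def)
  have u_i: "real (u i) = flips h r i - 2 * T"
    using i(1) unfolding u T_def by (simp add: of_nat_diff)
  have u_ge: "flips h r j - 2 * T \<le> u j" for j
    unfolding u T_def by (cases "2 * L ^ 3 \<le> flips h r j") (simp_all add: of_nat_diff not_le flip: of_nat_power)
  have JT: "u i + T \<le> (L * J h i) * T"
    using J[OF i(2)] u_i by (simp add: algebra_simps abs_le_iff)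
  then have "1 * T \<le> (L * J h i) * T" by simp
  then have "1 \<le> L * J h i" using T by (simp only: mult_le_cancel_right_pos)
  then show "1 / L \<le> J h i" using L_pos by (simp add: field_simps)
  show "2 * \<epsilon> * c ! i \<le> opt * J h i"
  proof (cases "opt = 0")
    case True
    then show ?thesis using query_legal(3)[OF assms(2)] by simp
  next
    case False
    define \<mu> where "\<mu> = 2 * \<epsilon> / opt"
    have \<mu>: "0 < \<mu>" "\<mu> * opt = 2 * \<epsilon>" using False eps by (simp_all add: \<mu>_def)
    \<comment> \<open>3/L is the cut-off 2/L plus the sampling error 1/L, so the score of such a
      \<open>j\<close> exceeds \<open>L ^ 4 * \<mu> * c ! j\<close>.\<close>
    have "\<exists>j<n. \<mu> * real (c ! j) + 3 / L < J h j"
    proof (rule ccontr)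
      assume "\<not> ?thesis"
      then have "4 * (p h * (1 - p h)) \<le> \<mu> * opt + 3 / L * n"
        using \<mu>(1) by (intro OSSS) (meson not_le, simp_all)
      moreover have "3 / L * n \<le> 1 / k"
        by (rule inv_L_le)
      moreover have "6 / k \<le> 4 * (p h * (1 - p h))"
        using assms by (intro query_mean) (auto simp: good_def)
      \<comment> \<open>The contradiction is 4\<epsilon> \<le> 6/k \<le> 2\<epsilon> + 1/k \<le>
        3\<epsilon>.\<close>
      moreover have "4 * \<epsilon> \<le> 6 / k"
        using k_bounds by (simp add: field_simps)
      ultimately show False
        using inv_k_le \<mu>(2) eps by linarith
    qed
    then obtain j where j: "j < n" "\<mu> * real (c ! j) + 3 / L < J h j" by blast
    then have "(L * T) * (\<mu> * real (c ! j) + 3 / L) < (L * T) * J h j"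
      using L_pos T by (intro mult_strict_left_mono) auto
    moreover have "(L * T) * (\<mu> * real (c ! j) + 3 / L) = L * T * \<mu> * real (c ! j) + 3 * T"
      using L_pos by (simp add: distrib_left)
    ultimately have "L * T * \<mu> * real (c ! j) + 3 * T < L * T * J h j"
      by (simp only:)
    then have uj: "L * T * \<mu> * real (c ! j) < u j"
      using J[OF j(1)] u_ge[of j] by (simp add: abs_le_iff)
    have cross: "real (u j) * c ! i \<le> real (u i) * c ! j"
      using i(3)[OF j(1)] by (metis of_nat_le_iff of_nat_mult)
    have "L * T * \<mu> * c ! i \<le> u i"
    proof (cases "c ! j = 0")
      \<comment> \<open>A free coordinate with positive score loses only to another free one, so
        maximality forces \<open>c ! i = 0\<close>.\<close>
      case True
      then have "u j * c ! i = 0" "0 < u j" using uj i(3)[OF j(1)] by auto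
      then show ?thesis by simp
    next
      case False
      have "(L * T * \<mu> * c ! i) * c ! j \<le> real (u j) * c ! i"
        using mult_right_mono[OF less_imp_le[OF uj], of "real (c ! i)"] by (simp add: mult_ac)
      also have "\<dots> \<le> real (u i) * c ! j" by (rule cross)
      finally show ?thesis using False by simp
    qed
    moreover have "L * T * \<mu> * c ! i = (L * (\<mu> * c ! i)) * T" by (simp add: mult_ac)
    ultimately have "(L * (\<mu> * c ! i)) * T \<le> (L * J h i) * T"
      using JT T by linarith
    then have "\<mu> * c ! i \<le> J h i" using T L_pos by simp
    then show ?thesis using False by (simp add: \<mu>_def field_simps)
  qed
qed

text \<open>The rarer value has probability at most 5/k: its estimate is below 4/k and the error at
  most 1/k, or no influence is visible and OSSS with \<open>\<mu> = 0\<close> bounds the variance by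
  1/k. A wrong majority vote requires a near tie and costs at most 2/L more.\<close>

lemma output_good:
  assumes "good h r" "act h r = Output y"
  shows "avg n (\<lambda>x. of_bool (f (override h x) \<noteq> y)) \<le> 7 * \<epsilon>"
proof -
  define T where "T = real L ^ 3"
  have T: "0 < T" using L_pos by (simp add: T_def)
  define K where "K = real (positives h r)"
  have L4T: "real L ^ 4 = L * T" by (simp add: T_def power_numeral_reduce)
  have K: "\<bar>K - L * p h * T\<bar> \<le> T"
    using assms(1) by (simp add: good_def good_mean_def T_def K_def power_numeral_reduce mult_ac)
  have margin: "real (margin n k) = 12 * N * T"
    by (simp add: margin_eq T_def)
  consider "positives h r < margin n k" | "L ^ 4 < positives h r + margin n k"
    | "\<forall>j<n. score (\<lambda>x. f x = 1) n k h r j = 0"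
    using assms(2) by (cases rule: action_cases[of h r]) auto
  then have "min (p h) (1 - p h) \<le> 5 / k"
  proof cases
    case 1
    then have "K \<le> 12 * N * T"
      using margin unfolding K_def by linarith
    then have "L * p h * T \<le> (12 * N + 1) * T"
      using K by (simp add: algebra_simps abs_le_iff)
    then have "L * p h \<le> 12 * N + 1" using T by simp
    also have "\<dots> \<le> L * (5 / k)" using k_bounds(3) N_ge by (simp add: L_eq)
    finally have "p h \<le> 5 / k" using L_pos by (simp only: mult_le_cancel_left_pos of_nat_0_less_iff)
    then show ?thesis by simp
  next
    case 2
    then have "L * T \<le> K + 12 * N * T"
      using of_nat_mono[OF less_imp_le[OF 2], where 'a = real] margin L4T unfolding K_def by simp
    then have "L * (1 - p h) * T \<le> (12 * N + 1) * T"
      using K by (simp add: algebra_simps abs_le_iff)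
    then have "L * (1 - p h) \<le> 12 * N + 1" using T by simp
    also have "\<dots> \<le> L * (5 / k)" using k_bounds(3) N_ge by (simp add: L_eq)
    finally have "1 - p h \<le> 5 / k" using L_pos by (simp only: mult_le_cancel_left_pos of_nat_0_less_iff)
    then show ?thesis by simp
  next
    case 3
    have J3: "J h j \<le> 0 * real (c ! j) + 3 / L" if "j < n" for j
    proof -
      have "flips h r j \<le> 2 * L ^ 3" using 3 that by (simp add: score_def)
      from of_nat_mono[OF this, where 'a = real] have "real (flips h r j) \<le> 2 * T"
        by (simp add: T_def)
      moreover have "\<bar>real (flips h r j) - L * T * J h j\<bar> \<le> T"
        using assms(1) that by (simp add: good_def T_def power_numeral_reduce)
      ultimately have "(L * J h j) * T \<le> 3 * T" by (simp add: algebra_simps abs_le_iff)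
      then have "L * J h j \<le> 3" using T by simp
      then show ?thesis using L_pos by (simp add: field_simps)
    qed
    have "4 * (p h * (1 - p h)) \<le> 0 * real opt + 3 / L * n"
      by (rule OSSS[OF J3]) simp_all
    also have "\<dots> \<le> 1 / k"
      using inv_L_le(2) by simp
    finally have "p h * (1 - p h) \<le> 1 / k / 4" by simp
    moreover have "min (p h) (1 - p h) * (1 / 2) \<le> p h * (1 - p h)"
    proof (cases "p h \<le> 1 / 2")
      case True
      then show ?thesis using p_bounds[of h] by (intro mult_mono) auto
    next
      case False
      then have "min (p h) (1 - p h) * (1 / 2) \<le> (1 - p h) * p h"
        using p_bounds[of h] by (intro mult_mono) auto
      then show ?thesis by (simp add: mult.commute)
    qed
    ultimately have "min (p h) (1 - p h) * (1 / 2) \<le> 1 / k / 4" by (rule order_trans[rotated])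
    also have "\<dots> \<le> 5 / k * (1 / 2)" using k_bounds(3) by (simp add: field_simps)
    finally show ?thesis by (simp only: mult_le_cancel_right_pos half_gt_zero_iff zero_less_one)
  qed
  moreover have "avg n (\<lambda>x. of_bool (f (override h x) \<noteq> y)) \<le> min (p h) (1 - p h) + 2 / L"
  proof -
    have y: "y = (if L ^ 4 \<le> 2 * positives h r then 1 else -1)"
      using assms(2) by (cases rule: action_cases[of h r]) auto
    show ?thesis
    proof (cases "L ^ 4 \<le> 2 * positives h r")
      case True
      then have "L * T \<le> 2 * K"
        using of_nat_mono[OF True, where 'a = real] L4T unfolding K_def by simp
      then have "(L * (1 - 2 * p h)) * T \<le> 2 * T" using K by (simp add: algebra_simps abs_le_iff)
      then have "L * (1 - 2 * p h) \<le> 2" using T by simp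
      then have "1 - 2 * p h \<le> 2 / L" using L_pos by (simp add: field_simps)
      moreover have "avg n (\<lambda>x. of_bool (f (override h x) \<noteq> y)) = 1 - p h"
        using True y avg_diff[of n "\<lambda>x. 1" "\<lambda>x. of_bool (f (override h x) = 1)"]
        by (simp add: p_def of_bool_not_iff)
      moreover have "0 \<le> 2 / real L" by simp
      ultimately show ?thesis by linarith
    next
      case False
      then have "2 * K \<le> L * T"
        using of_nat_mono[OF less_imp_le[OF not_le_imp_less[OF False]], where 'a = real] L4T unfolding K_def by simp
      then have "(L * (2 * p h - 1)) * T \<le> 2 * T" using K by (simp add: algebra_simps abs_le_iff)
      then have "L * (2 * p h - 1) \<le> 2" using T by simp
      then have "2 * p h - 1 \<le> 2 / L" using L_pos by (simp add: field_simps)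
      moreover have "avg n (\<lambda>x. of_bool (f (override h x) \<noteq> y)) = p h"
        unfolding p_def using False y fh_range[of h] by (intro avg_cong) (auto simp: Pi_def)
      moreover have "0 \<le> 2 / real L" by simp
      ultimately show ?thesis by linarith
    qed
  qed
  moreover have "5 / k + 2 / L \<le> 7 * \<epsilon>"
    using inv_L_le(1) inv_k_le by (simp add: divide_inverse)
  ultimately show ?thesis by linarith
qed

end

section \<open>Charging the cost of an action to the drop of influence\<close>

lemma sum_scaleR_cube: "(\<Sum>x\<in>cube n. \<phi> x /\<^sub>R real (card (cube n))) = avg n \<phi>"
  by (simp add: avg_def sum_distrib_right divide_inverse mult.commute)

context query_instance
begin

definition pay :: "action \<Rightarrow> real" where
  "pay a = (case a of Query i \<Rightarrow> real (c ! i) | Output y \<Rightarrow> 0)"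

text \<open>The drop of the potential \<open>total\<close>: for a query its mean over the two
  answers, for an output all that is left, since no cost follows.\<close>

definition gain :: "history \<Rightarrow> action \<Rightarrow> real" where
  "gain h a = (case a of Query i \<Rightarrow> J h i | Output y \<Rightarrow> total h)"

lemma gain_nonneg: "0 \<le> gain h a"
  by (cases a) (simp_all add: gain_def J_nonneg total_nonneg)

lemma pay_le_opt: "pay (act h r) \<le> opt"
  using query_legal(3)[of h r] by (cases "act h r") (simp_all add: pay_def)

text \<open>If \<open>f\<close> is far from constant, good samples select a coordinate that is worth its cost; otherwise good
  samples stop, and bad ones are too rare to matter since a query never costs more than \<open>opt\<close>.\<close>

lemma pay_le_gain: "avg B (\<lambda>r. pay (act h r)) \<le> opt / \<epsilon> * avg B (\<lambda>r. gain h (act h r))"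
proof (cases "1 / L \<le> 4 * (p h * (1 - p h))")
  case True
  let ?Y = "avg B (\<lambda>r. gain h (act h r))"
  have good: "pay (act h r) \<le> opt / (2 * \<epsilon>) * gain h (act h r) \<and> 1 / L \<le> gain h (act h r)" if "good h r" for r
  proof (cases "act h r")
    case (Query i)
    then show ?thesis
      using query_good[OF that Query] eps by (simp add: pay_def gain_def field_simps)
  next
    case (Output y)
    then show ?thesis
      using True Poincare[of h] total_nonneg[of h] eps by (simp add: pay_def gain_def)
  qed
  have "avg B (\<lambda>r. pay (act h r)) \<le> avg B (\<lambda>r. opt / (2 * \<epsilon>) * gain h (act h r) + real opt * of_bool (\<not> good h r))"
  proof (rule avg_mono)
    fix r
    have "0 \<le> opt / (2 * \<epsilon>) * gain h (act h r)" using gain_nonneg eps by simp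
    then show "pay (act h r) \<le> opt / (2 * \<epsilon>) * gain h (act h r) + real opt * of_bool (\<not> good h r)"
      using good[of r] pay_le_opt[of h r] by (cases "good h r") simp_all
  qed
  also have "\<dots> = opt / (2 * \<epsilon>) * ?Y + opt * avg B (\<lambda>r. of_bool (\<not> good h r))"
    by (simp only: avg_add avg_mult)
  \<comment> \<open>A good sample gains at least 1/L, by a visible influence or, when stopping, by
    the Poincare inequality. So the mean gain is at least (1 - \<eta>)/L, which exceeds the
    probability of a bad sample.\<close>
  also have "\<dots> \<le> opt / (2 * \<epsilon>) * ?Y + opt * ?Y"
  proof -
    have "(1 - \<eta>) / L \<le> (1 - avg B (\<lambda>r. of_bool (\<not> good h r))) / L"
      using prob_bad[of h] by (intro divide_right_mono) simp_all
    also have "\<dots> = avg B (\<lambda>r. (1 - of_bool (\<not> good h r)) / L)"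
      by (simp only: avg_divide avg_diff avg_const)
    also have "\<dots> \<le> ?Y"
      using good gain_nonneg by (intro avg_mono) auto
    finally have "avg B (\<lambda>r. of_bool (\<not> good h r)) \<le> ?Y"
      using prob_bad[of h] \<eta>_bounds(2) by linarith
    then show ?thesis by (simp add: mult_left_mono)
  qed
  \<comment> \<open>Here \<epsilon> < 1/2 turns the charge for bad samples into the reserved
    half.\<close>
  also have "\<dots> \<le> opt / (2 * \<epsilon>) * ?Y + opt / (2 * \<epsilon>) * ?Y"
  proof -
    have "real opt * 1 \<le> opt * (1 / (2 * \<epsilon>))" using eps by (intro mult_left_mono) (simp_all add: field_simps)
    then have "opt * ?Y \<le> opt / (2 * \<epsilon>) * ?Y"
      using gain_nonneg by (intro mult_right_mono avg_nonneg) simp_all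
    then show ?thesis by (rule add_left_mono)
  qed
  also have "\<dots> = opt / \<epsilon> * ?Y" by (simp add: field_simps)
  finally show ?thesis .
next
  case False
  let ?q = "p h * (1 - p h)"
  have q: "0 \<le> ?q" using p_bounds[of h] by simp
  have "1 / L \<le> 1" using L_ge by simp
  then have q1: "?q \<le> 1 / 2" using False by linarith
  have out: "\<exists>y. act h r = Output y" if "good_mean h r" for r
  proof (cases "act h r")
    case (Query i)
    have "6 / k \<le> 4 * ?q" by (rule query_mean[OF that Query])
    moreover have "1 / k \<le> 6 / real k" by (simp add: divide_right_mono)
    ultimately show ?thesis using False inv_L_le(1) by linarith
  qed simp
  have "?q / L\<^sup>2 \<le> ?q / 1"
    using q L_ge by (intro divide_left_mono) (simp_all add: power2_eq_square flip: of_nat_mult)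
  then have bad: "avg B (\<lambda>r. of_bool (\<not> good_mean h r)) \<le> ?q"
    using prob_bad_mean[of h] by simp
  have "avg B (\<lambda>r. pay (act h r)) \<le> avg B (\<lambda>r. real opt * of_bool (\<not> good_mean h r))"
  proof (rule avg_mono)
    fix r
    show "pay (act h r) \<le> real opt * of_bool (\<not> good_mean h r)"
      using out[of r] pay_le_opt[of h r] by (cases "good_mean h r") (auto simp: pay_def)
  qed
  also have "\<dots> \<le> opt * ?q"
    using bad by (simp add: avg_mult mult_left_mono)
  also have "\<dots> \<le> opt * avg B (\<lambda>r. gain h (act h r))"
  proof -
    \<comment> \<open>Poincare gives \<open>total h \<ge> 4 * ?q\<close>, and
      \<open>?q \<le> 1 / 2\<close>, so stopping with probability at least \<open>1 - ?q\<close>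
      releases enough influence to cover the queries made on bad samples.\<close>
    have "?q \<le> total h * (1 - ?q)"
    proof -
      have "4 * ?q * (1 / 2) \<le> total h * (1 - ?q)"
        using Poincare[of h] q q1 by (intro mult_mono) auto
      then show ?thesis using q by linarith
    qed
    also have "\<dots> \<le> total h * avg B (\<lambda>r. 1 - of_bool (\<not> good_mean h r))"
      using bad total_nonneg by (intro mult_left_mono) (simp_all add: avg_diff)
    also have "\<dots> = avg B (\<lambda>r. total h * (1 - of_bool (\<not> good_mean h r)))"
      by (simp only: avg_mult)
    also have "\<dots> \<le> avg B (\<lambda>r. gain h (act h r))"
    proof (rule avg_mono)
      fix r
      show "total h * (1 - of_bool (\<not> good_mean h r)) \<le> gain h (act h r)"
        using out[of r] gain_nonneg[of h "act h r"] by (cases "good_mean h r") (auto simp: gain_def)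
    qed
    finally show ?thesis by (simp add: mult_left_mono)
  qed
  also have "\<dots> \<le> opt / \<epsilon> * avg B (\<lambda>r. gain h (act h r))"
    using eps gain_nonneg by (intro mult_right_mono avg_nonneg) (simp_all add: field_simps mult_left_le_one_le)
  finally show ?thesis .
qed


section \<open>Running the strategy\<close>

definition S :: strategy where
  "S h = map_pmf (act h) (pmf_of_set (cube B))"

lemma act_cases_legal: "legal_action n h (act h r)"
proof (cases "act h r")
  case (Query i)
  then show ?thesis using query_legal[OF Query] by (simp add: legal_action_def)
next
  case (Output y)
  then show ?thesis by (cases rule: action_cases[of h r]) (auto simp: legal_action_def)
qed

lemma is_strategy_S: "is_strategy n S"
  by (auto simp: is_strategy_def S_def act_cases_legal)

lemma finite_play: "finite (set_pmf (play j S x h))"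
proof (induction j arbitrary: h)
  case (Suc j)
  then show ?case by (auto simp: S_def set_pmf_of_set split: action.split)
qed simp

lemma expectation_play_Suc:
  "measure_pmf.expectation (play (Suc j) S x h) \<psi> = avg B (\<lambda>r. case act h r of
     Query i \<Rightarrow> measure_pmf.expectation (play j S x (h @ [(i, x ! i)])) \<psi> | Output y \<Rightarrow> \<psi> (h, y))"
proof -
  have "measure_pmf.expectation (play (Suc j) S x h) \<psi> = (\<Sum>r\<in>cube B. measure_pmf.expectation
      (case act h r of Query i \<Rightarrow> play j S x (h @ [(i, x ! i)]) | Output y \<Rightarrow> return_pmf (h, y)) \<psi> /\<^sub>R real (card (cube B)))"
    unfolding play.simps S_def bind_map_pmf
    by (rule pmf_expectation_bind_pmf_of_set) (auto simp: finite_play[unfolded S_def] split: action.split)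
  also have "\<dots> = avg B (\<lambda>r. measure_pmf.expectation
      (case act h r of Query i \<Rightarrow> play j S x (h @ [(i, x ! i)]) | Output y \<Rightarrow> return_pmf (h, y)) \<psi>)"
    by (rule sum_scaleR_cube)
  also have "\<dots> = avg B (\<lambda>r. case act h r of
     Query i \<Rightarrow> measure_pmf.expectation (play j S x (h @ [(i, x ! i)])) \<psi> | Output y \<Rightarrow> \<psi> (h, y))"
    by (rule avg_cong) (auto split: action.split)
  finally show ?thesis .
qed

text \<open>The expected payoff once \<open>h\<close> has been reached: overriding a uniform point
  by \<open>h\<close> gives a uniform input conditioned on \<open>h\<close>. The payoff also sees
  the true input, as the error requires.\<close>

definition play_value :: "nat \<Rightarrow> history \<Rightarrow> (bool list \<Rightarrow> history \<times> int \<Rightarrow> real) \<Rightarrow> real" where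
  "play_value j h \<phi> = avg n (\<lambda>x. measure_pmf.expectation (play j S (override h x) h) (\<phi> (override h x)))"

text \<open>The action depends on the history and the samples only, so the average over inputs can
  be taken inside. A queried coordinate is fresh, hence a fair bit given \<open>h\<close>, and the
  two branches have equal weight.\<close>

lemma play_value_Suc:
  "play_value (Suc j) h \<phi> = avg B (\<lambda>r. case act h r of
     Query i \<Rightarrow> (play_value j (h @ [(i, True)]) \<phi> + play_value j (h @ [(i, False)]) \<phi>) / 2
   | Output y \<Rightarrow> avg n (\<lambda>x. \<phi> (override h x) (h, y)))"
  unfolding play_value_def expectation_play_Suc avg_swap[of n]
proof (rule avg_cong)
  fix r
  show "avg n (\<lambda>x. case act h r of
          Query i \<Rightarrow> measure_pmf.expectation (play j S (override h x) (h @ [(i, override h x ! i)])) (\<phi> (override h x))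
        | Output y \<Rightarrow> \<phi> (override h x) (h, y))
    = (case act h r of
        Query i \<Rightarrow> (avg n (\<lambda>x. measure_pmf.expectation (play j S (override (h @ [(i, True)]) x) (h @ [(i, True)])) (\<phi> (override (h @ [(i, True)]) x)))
          + avg n (\<lambda>x. measure_pmf.expectation (play j S (override (h @ [(i, False)]) x) (h @ [(i, False)])) (\<phi> (override (h @ [(i, False)]) x)))) / 2
      | Output y \<Rightarrow> avg n (\<lambda>x. \<phi> (override h x) (h, y)))"
  proof (cases "act h r")
    case (Query i)
    note i = query_legal[OF Query]
    have x: "override h (x[i := b]) = override (h @ [(i, b)]) x \<and> override (h @ [(i, b)]) x ! i = b"
      if "x \<in> cube n" for x b
      using that i by (simp add: override_append override_update cube_def)
    show ?thesis
      unfolding Query action.case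
      by (subst avg_split[OF i(1)]) (intro arg_cong2[of _ _ _ _ "\<lambda>a b. (a + b) / 2"] avg_cong, simp_all only: x)
  qed simp
qed

lemma total_append:
  assumes "i < n" "i \<notin> fst ` set h"
  shows "(total (h @ [(i, True)]) + total (h @ [(i, False)])) / 2 = total h - J h i"
  using sum_infl_restrict[OF assms(1), of "\<lambda>x. f (override h x)"] assms(2)
  by (simp add: total_def J_def override_append override_update)

text \<open>Cost so far plus opt/\<epsilon> times the remaining influence is a supermartingale: one
  action changes its mean by pay minus opt/\<epsilon> times gain, which \<open>pay_le_gain\<close>
  makes at most 0.\<close>

lemma play_value_cost:
  assumes "is_history n h"
  shows "play_value j h (\<lambda>x (h', y). real (hist_cost c h')) \<le> hist_cost c h + opt / \<epsilon> * total h"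
  using assms
proof (induction j arbitrary: h)
  case 0
  have "0 \<le> opt / \<epsilon> * total h" using eps total_nonneg by simp
  then show ?case by (simp add: play_value_def)
next
  case (Suc j)
  let ?A = "opt / \<epsilon>" and ?\<phi> = "\<lambda>x (h', y). real (hist_cost c h')"
  have "play_value (Suc j) h ?\<phi> \<le> avg B (\<lambda>r. (hist_cost c h + ?A * total h) + pay (act h r) - ?A * gain h (act h r))"
    unfolding play_value_Suc
  proof (rule avg_mono)
    fix r
    show "(case act h r of
        Query i \<Rightarrow> (play_value j (h @ [(i, True)]) ?\<phi> + play_value j (h @ [(i, False)]) ?\<phi>) / 2
      | Output y \<Rightarrow> avg n (\<lambda>x. ?\<phi> (override h x) (h, y)))
      \<le> (hist_cost c h + ?A * total h) + pay (act h r) - ?A * gain h (act h r)"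
    proof (cases "act h r")
      case (Query i)
      note i = query_legal[OF Query]
      have "play_value j (h @ [(i, b)]) ?\<phi> \<le> hist_cost c h + c ! i + ?A * total (h @ [(i, b)])" for b
        using Suc.IH[OF is_history_append[OF Suc.prems i(1,2)], of b] by simp
      moreover have "(u + v) / 2 \<le> a + (d + e) / 2" if "u \<le> a + d" "v \<le> a + e" for u v a d e :: real
      proof -
        have "(u + v) / 2 \<le> (2 * a + (d + e)) / 2" using that by (intro divide_right_mono) simp_all
        then show ?thesis by (simp add: add_divide_distrib)
      qed
      ultimately have "(play_value j (h @ [(i, True)]) ?\<phi> + play_value j (h @ [(i, False)]) ?\<phi>) / 2
          \<le> hist_cost c h + c ! i + (?A * total (h @ [(i, True)]) + ?A * total (h @ [(i, False)])) / 2"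
        by blast
      also have "(?A * total (h @ [(i, True)]) + ?A * total (h @ [(i, False)])) / 2 = ?A * (total h - J h i)"
        unfolding total_append[OF i(1,2), symmetric] by (simp add: distrib_left)
      finally show ?thesis
        unfolding Query pay_def gain_def by (simp add: right_diff_distrib)
    qed (simp add: pay_def gain_def)
  qed
  also have "\<dots> = (hist_cost c h + ?A * total h)
      + (avg B (\<lambda>r. pay (act h r)) - ?A * avg B (\<lambda>r. gain h (act h r)))"
    by (simp only: avg_add avg_diff avg_mult avg_const)
  also have "\<dots> \<le> hist_cost c h + ?A * total h"
    using pay_le_gain[of h] by simp
  finally show ?case by simp
qed

text \<open>Each action adds the probability \<eta> of a bad sample. The bound on \<open>j\<close>
  guarantees that an output is made before the budget is exhausted, so the default answer of
  \<open>play\<close> does not count.\<close>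

lemma play_value_error:
  assumes "is_history n h" "n - length h < j"
  shows "play_value j h (\<lambda>x (h', y). of_bool (y \<noteq> f x)) \<le> 7 * \<epsilon> + j * \<eta>"
  using assms
proof (induction j arbitrary: h)
  case (Suc j)
  let ?\<phi> = "\<lambda>x (h', y). of_bool (y \<noteq> f x) :: real"
  have "play_value (Suc j) h ?\<phi> \<le> avg B (\<lambda>r. of_bool (\<not> good h r) + (7 * \<epsilon> + j * \<eta>))"
    unfolding play_value_Suc
  proof (rule avg_mono)
    fix r
    show "(case act h r of
        Query i \<Rightarrow> (play_value j (h @ [(i, True)]) ?\<phi> + play_value j (h @ [(i, False)]) ?\<phi>) / 2
      | Output y \<Rightarrow> avg n (\<lambda>x. ?\<phi> (override h x) (h, y)))
      \<le> of_bool (\<not> good h r) + (7 * \<epsilon> + j * \<eta>)"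
    proof (cases "act h r")
      case (Query i)
      note i = query_legal[OF Query]
      have "length h < n"
        using is_history_length[OF is_history_append[OF Suc.prems(1) i(1,2)], of True] by simp
      then have "play_value j (h @ [(i, b)]) ?\<phi> \<le> 7 * \<epsilon> + j * \<eta>" for b
        using Suc.prems(2) by (intro Suc.IH is_history_append[OF Suc.prems(1) i(1,2)]) simp
      from this[of True] this[of False] show ?thesis
        unfolding Query action.case by (cases "good h r") simp_all
    next
      case (Output y)
      have "avg n (\<lambda>x. of_bool (y \<noteq> f (override h x))) \<le> of_bool (\<not> good h r) + 7 * \<epsilon>"
      proof (cases "good h r")
        case True
        then show ?thesis using output_good[OF True Output] by (simp add: eq_commute)
      next
        case False
        have "avg n (\<lambda>x. of_bool (y \<noteq> f (override h x))) \<le> 1" by (rule avg_le_const) simp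
        then show ?thesis using False eps by simp
      qed
      moreover have "0 \<le> j * \<eta>" using \<eta>_bounds(1) by simp
      ultimately show ?thesis
        unfolding Output action.case prod.case by linarith
    qed
  qed
  also have "\<dots> = avg B (\<lambda>r. of_bool (\<not> good h r)) + (7 * \<epsilon> + j * \<eta>)"
    by (simp only: avg_add avg_const)
  also have "\<dots> \<le> \<eta> + (7 * \<epsilon> + j * \<eta>)"
    using prob_bad by simp
  also have "\<dots> = 7 * \<epsilon> + Suc j * \<eta>"
    by (simp add: algebra_simps)
  finally show ?case .
qed simp

lemma expected_cost_S: "expected_cost n c S \<le> opt * total_influence n f / \<epsilon>"
proof -
  have "expected_cost n c S = (\<Sum>x\<in>cube n. measure_pmf.expectation (cost_pmf n c S x) real /\<^sub>R real (card (cube n)))"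
    unfolding expected_cost_def
    by (rule pmf_expectation_bind_pmf_of_set) (auto simp: cost_pmf_def run_def finite_play simp del: play.simps)
  also have "\<dots> = play_value (Suc n) [] (\<lambda>x (h', y). real (hist_cost c h'))"
    unfolding sum_scaleR_cube by (simp add: play_value_def cost_pmf_def run_def case_prod_beta' del: play.simps)
  also have "\<dots> \<le> opt / \<epsilon> * total []"
    using play_value_cost[of "[]" "Suc n"] by (simp add: is_history_def)
  also have "total [] = total_influence n f"
    by (simp add: total_def J_def total_influence_eq)
  finally show ?thesis by simp
qed

text \<open>7\<epsilon> comes from outputs on good samples, the remaining \<epsilon> from bad
  samples in at most \<open>n + 1\<close> actions.\<close>

lemma error_prob_S: "error_prob n f S \<le> 8 * \<epsilon>"
proof -
  let ?M = "\<lambda>x. map_pmf (\<lambda>y. (x, y)) (output_pmf n S x)"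
  let ?e = "\<lambda>z. of_bool (snd z \<noteq> f (fst z)) :: real"
  have "?e = indicator {(x, y). y \<noteq> f x}"
    by (auto simp: fun_eq_iff indicator_def)
  then have "error_prob n f S = measure_pmf.expectation (pmf_of_set (cube n) \<bind> ?M) ?e"
    by (simp add: error_prob_def)
  also have "\<dots> = (\<Sum>x\<in>cube n. measure_pmf.expectation (?M x) ?e /\<^sub>R real (card (cube n)))"
    by (rule pmf_expectation_bind_pmf_of_set) (auto simp: output_pmf_def run_def finite_play simp del: play.simps)
  also have "\<dots> = play_value (Suc n) [] (\<lambda>x (h', y). of_bool (y \<noteq> f x))"
    unfolding sum_scaleR_cube
    by (simp add: play_value_def output_pmf_def run_def case_prod_beta' del: play.simps)
  also have "\<dots> \<le> 7 * \<epsilon> + Suc n * \<eta>"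
    by (rule play_value_error) (simp_all add: is_history_def)
  also have "\<dots> \<le> 8 * \<epsilon>"
    using \<eta>_bounds(3) by (simp add: N_def add.commute)
  finally show ?thesis .
qed

lemma S_correct:
  "error_strategy n f (8 * \<epsilon>) S \<and> expected_cost n c S \<le> opt * total_influence n f / \<epsilon>"
  by (simp add: error_strategy_def is_strategy_S error_prob_S expected_cost_S)

end

section \<open>Efficiency, and the theorem\<close>

lemma data_size_pos: "1 \<le> data_size d"
  by (cases d) auto

lemma length_le_data_size: "length xs \<le> data_size (enc_list e xs)"
proof (induction xs)
  case (Cons x xs)
  then show ?case using data_size_pos[of "e x"] by simp
qed simp

text \<open>All samples lie in the cube, so a predicate computed from a representation may replace
  the function wherever both agree there.\<close>

lemma next_action_cong:
  assumes "\<And>x. x \<in> cube (length c) \<Longrightarrow> g x = g' x"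
  shows "next_action g c k h r = next_action g' c k h r"
proof -
  have "g (override h' (block (length c) r j)) = g' (override h' (block (length c) r j))" for h' j
    using assms by simp
  moreover from this have "score g (length c) k h r = score g' (length c) k h r"
    by (simp add: score_def hits_def fun_eq_iff)
  ultimately show ?thesis
    by (simp add: next_action_def hits_def Let_def)
qed

theorem theorem2:
  shows "\<exists>C > 0. \<forall>R. representation_scheme R \<longrightarrow>
    (\<exists>S. efficient R S \<and>
      (\<forall>(n :: nat) (f :: bool list \<Rightarrow> int) (c :: nat list) (\<epsilon> :: real) (w :: data).
         f \<in> cube n \<rightarrow> {-1, 1} \<and> length c = n \<and> 0 < \<epsilon> \<and> \<epsilon> < 1 / 2 \<and> R n w f \<longrightarrow>
           error_strategy n f (C * \<epsilon>) (S w c \<epsilon>) \<and>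
           expected_cost n c (S w c \<epsilon>)
             \<le> real (opt_worst n f c 0) * total_influence n f / \<epsilon>))"
proof (intro exI[of _ 8] conjI allI impI)
  fix R :: scheme
  assume "representation_scheme R"
  then obtain P p where R: "\<And>n w f. R n w f \<Longrightarrow> f \<in> cube n \<rightarrow> {-1, 1}"
    and P: "\<And>n w f x. R n w f \<Longrightarrow> x \<in> cube n \<Longrightarrow>
      halts_within P (Join w (enc_bits x)) (poly p (data_size w + n)) (enc_sign (f x))"
    unfolding representation_scheme_def by metis
  \<comment> \<open>The strategy is given the representation \<open>w\<close> and not
    \<open>f\<close>, so it is defined from what the evaluator \<open>P\<close> returns; determinism
    of \<open>exec\<close> identifies this with \<open>f\<close>.\<close>
  define val where "val w x \<longleftrightarrow> (\<exists>t. exec P (Join w (enc_bits x)) t (Atom 1))" for w x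
  have val: "val w x \<longleftrightarrow> f x = 1" if Rx: "R n w f" "x \<in> cube n" for n w f x
  proof -
    obtain t where t: "exec P (Join w (enc_bits x)) t (enc_sign (f x))"
      using P[OF Rx] by (auto simp: halts_within_def)
    then have "val w x \<longleftrightarrow> enc_sign (f x) = Atom 1"
      unfolding val_def using exec_det by metis
    then show ?thesis by (simp add: enc_sign_def)
  qed
  \<comment> \<open>With instance size N the samples use at most N (3 N N)^4 = 81 N^9 bits.\<close>
  define q :: "nat poly" where "q = monom 81 9"
  define K :: "real \<Rightarrow> nat" where "K \<epsilon> = nat \<lceil>1 / \<epsilon>\<rceil>" for \<epsilon>
  define S where S_eq: "S w c \<epsilon> h = map_pmf (next_action (val w) c (K \<epsilon>) h)
    (pmf_of_set (cube (poly q (data_size (enc_instance w c \<epsilon>)))))" for w c \<epsilon> h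
  have size: "data_size w + length c < data_size (enc_instance w c \<epsilon>)" "K \<epsilon> < data_size (enc_instance w c \<epsilon>)" for w c \<epsilon>
    using length_le_data_size[of c Atom] length_le_data_size[of "replicate (K \<epsilon>) 0" Atom]
    unfolding enc_instance_def K_def[symmetric] data_size.simps length_replicate by linarith+
  have bits: "length c * scale (length c) (K \<epsilon>) ^ 4 \<le> poly q (data_size (enc_instance w c \<epsilon>))" for w c \<epsilon>
  proof -
    let ?N = "data_size (enc_instance w c \<epsilon>)"
    have "length c * scale (length c) (K \<epsilon>) ^ 4 \<le> ?N * (3 * ?N * ?N) ^ 4"
      unfolding scale_def using size(1)[of w c \<epsilon>] size(2)[of \<epsilon> w c] by (intro mult_le_mono power_mono) auto
    then show ?thesis by (simp add: q_def poly_monom power_mult_distrib power_numeral_reduce mult_ac)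
  qed
  show "\<exists>S. efficient R S \<and>
      (\<forall>n f c \<epsilon> w. f \<in> cube n \<rightarrow> {-1, 1} \<and> length c = n \<and> 0 < \<epsilon> \<and> \<epsilon> < 1 / 2 \<and> R n w f \<longrightarrow>
           error_strategy n f (8 * \<epsilon>) (S w c \<epsilon>) \<and>
           expected_cost n c (S w c \<epsilon>) \<le> real (opt_worst n f c 0) * total_influence n f / \<epsilon>)"
  proof (intro exI[of _ S] conjI allI impI; (elim conjE)?)
    \<comment> \<open>Only the instance counts towards the size; the history has at most
      \<open>n\<close> entries, and the number of random bits is \<open>q\<close> of this
      size.\<close>
    define sz :: "nat \<times> data \<times> (bool list \<Rightarrow> int) \<times> nat list \<times> real \<times> history \<times> bool list \<Rightarrow> nat"
      where "sz = (\<lambda>(n, w, f, c, \<epsilon>, h, r). data_size (enc_instance w c \<epsilon>))"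
    define A where "A = {(n, w, f, c, \<epsilon>, h, r). R n w f \<and> length c = n \<and> is_history n h \<and>
      r \<in> cube (poly q (data_size (enc_instance w c \<epsilon>)))}"
    define inp where "inp = (\<lambda>(n :: nat, w, f :: bool list \<Rightarrow> int, c, \<epsilon>, h, r).
      Join (enc_instance w c \<epsilon>) (Join (enc_history h) (enc_bits r)))"
    define c' :: "nat \<times> data \<times> (bool list \<Rightarrow> int) \<times> nat list \<times> real \<times> history \<times> bool list \<Rightarrow> nat list"
      where "c' = (\<lambda>(n, w, f, c, \<epsilon>, h, r). c)"
    define w' :: "nat \<times> data \<times> (bool list \<Rightarrow> int) \<times> nat list \<times> real \<times> history \<times> bool list \<Rightarrow> data"
      where "w' = (\<lambda>(n, w, f, c, \<epsilon>, h, r). w)"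
    define k' :: "nat \<times> data \<times> (bool list \<Rightarrow> int) \<times> nat list \<times> real \<times> history \<times> bool list \<Rightarrow> nat"
      where "k' = (\<lambda>(n, w, f, c, \<epsilon>, h, r). K \<epsilon>)"
    define h' :: "nat \<times> data \<times> (bool list \<Rightarrow> int) \<times> nat list \<times> real \<times> history \<times> bool list \<Rightarrow> history"
      where "h' = (\<lambda>(n, w, f, c, \<epsilon>, h, r). h)"
    define r' :: "nat \<times> data \<times> (bool list \<Rightarrow> int) \<times> nat list \<times> real \<times> history \<times> bool list \<Rightarrow> bool list"
      where "r' = (\<lambda>(n, w, f, c, \<epsilon>, h, r). r)"
    have inp: "inp = (\<lambda>a. Join (Join (w' a) (Join (enc_list Atom (c' a)) (enc_list Atom (replicate (k' a) 0))))
        (Join (enc_history (h' a)) (enc_bits (r' a))))"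
      by (auto simp: inp_def w'_def c'_def k'_def h'_def r'_def enc_instance_def K_def)
    have linear: "poly_bounded A sz l" if "\<And>a. a \<in> A \<Longrightarrow> l a \<le> sz a" for l
      unfolding poly_bounded_def by (rule exI[of _ "[:0, 1:]"]) (use that in simp)
    have len: "length (c' a) \<le> sz a" "k' a \<le> sz a" "length (h' a) \<le> sz a" if "a \<in> A" for a
      using that size is_history_length
      by (auto simp: A_def sz_def c'_def k'_def h'_def intro: less_imp_le order_trans dest: add_lessD1)
        (meson add_leE less_imp_le order_trans)+
    have "feasible A sz inp (\<lambda>a. enc_action (next_action (val (w' a)) (c' a) (k' a) (h' a) (r' a)))"
    proof (rule feasible_next_action)
      have "halts_within P (Join (w' a) (enc_bits x)) (poly p (sz a)) (enc_bool (val (w' a) x))"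
        if "a \<in> A" "x \<in> cube (length (c' a))" for a x
      proof -
        obtain n w f c \<epsilon> h r where a: "a = (n, w, f, c, \<epsilon>, h, r)" by (cases a)
        have Rx: "R n w f" "x \<in> cube n" "n = length c" using that by (auto simp: a A_def c'_def)
        have "enc_sign (f x) = enc_bool (val w x)"
          using val[OF Rx(1,2)] by (simp add: enc_sign_def enc_bool_def)
        moreover have "poly p (data_size w + n) \<le> poly p (sz a)"
          using size(1)[of w c \<epsilon>] Rx(3) by (intro poly_nat_mono) (simp add: sz_def a)
        ultimately show ?thesis
          using halts_within_mono[OF P[OF Rx(1,2)]] by (simp add: a w'_def)
      qed
      then show "evaluable A sz (\<lambda>a. length (c' a)) w' (\<lambda>a. val (w' a))"
        unfolding evaluable_def by blast
      have I: "feasible A sz inp (\<lambda>a. Join (w' a) (Join (enc_list Atom (c' a)) (enc_list Atom (replicate (k' a) 0))))"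
        and hr: "feasible A sz inp (\<lambda>a. Join (enc_history (h' a)) (enc_bits (r' a)))"
        using feasible_fst[OF feasible_id[of A sz inp, unfolded inp]] feasible_snd[OF feasible_id[of A sz inp, unfolded inp]]
        unfolding inp by blast+
      show "feasible A sz inp w'" "feasible A sz inp (\<lambda>a. enc_list Atom (c' a))"
        "feasible A sz inp (\<lambda>a. enc_history (h' a))" "feasible A sz inp (\<lambda>a. enc_bits (r' a))"
        using feasible_fst[OF I] feasible_fst[OF feasible_snd[OF I]] feasible_fst[OF hr] feasible_snd[OF hr]
        by blast+
      have "feasible A sz inp (\<lambda>a. Atom (length (replicate (k' a) (0 :: nat))))"
        by (rule feasible_length[OF feasible_snd[OF feasible_snd[OF I]]]) (simp add: linear len)
      then show "feasible A sz inp (\<lambda>a. Atom (k' a))" by simp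
      show "poly_bounded A sz (\<lambda>a. length (c' a))" "poly_bounded A sz k'" "poly_bounded A sz (\<lambda>a. length (h' a))"
        by (simp_all add: linear len)
      show "length (c' a) * scale (length (c' a)) (k' a) ^ 4 \<le> length (r' a)" if "a \<in> A" for a
        using that bits by (auto simp: A_def c'_def k'_def r'_def cube_def)
    qed
    then obtain Q s where Q: "\<And>a. a \<in> A \<Longrightarrow>
        halts_within Q (inp a) (poly s (sz a)) (enc_action (next_action (val (w' a)) (c' a) (k' a) (h' a) (r' a)))"
      unfolding feasible_def by metis
    show "efficient R S"
      unfolding efficient_def Let_def
    proof (rule exI[of _ Q], rule exI[of _ s], rule exI[of _ q], intro allI impI, elim conjE)
      fix n w f and c :: "nat list" and \<epsilon> :: real and h :: history
      assume a: "R n w f" "length c = n" "is_history n h"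
      have "halts_within Q (Join (enc_instance w c \<epsilon>) (Join (enc_history h) (enc_bits r)))
          (poly s (data_size (enc_instance w c \<epsilon>))) (enc_action (next_action (val w) c (K \<epsilon>) h r))"
        if "r \<in> cube (poly q (data_size (enc_instance w c \<epsilon>)))" for r
        using Q[of "(n, w, f, c, \<epsilon>, h, r)"] a that
        by (simp add: A_def inp_def sz_def w'_def c'_def k'_def h'_def r'_def)
      then show "\<exists>act. (\<forall>r\<in>cube (poly q (data_size (enc_instance w c \<epsilon>))).
             halts_within Q (Join (enc_instance w c \<epsilon>) (Join (enc_history h) (enc_bits r)))
              (poly s (data_size (enc_instance w c \<epsilon>))) (enc_action (act r))) \<and>
          S w c \<epsilon> h = map_pmf act (pmf_of_set (cube (poly q (data_size (enc_instance w c \<epsilon>)))))"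
        by (intro exI[of _ "next_action (val w) c (K \<epsilon>) h"]) (simp add: S_eq)
    qed
  next
    fix n f w and c :: "nat list" and \<epsilon> :: real
    assume a: "f \<in> cube n \<rightarrow> {-1, 1}" "length c = n" "0 < \<epsilon>" "\<epsilon> < 1 / 2" "R n w f"
    interpret query_instance n f c \<epsilon> "K \<epsilon>" "poly q (data_size (enc_instance w c \<epsilon>))"
      by unfold_locales (use a bits in \<open>auto simp: K_def\<close>)
    have "next_action (val w) c (K \<epsilon>) h = next_action (\<lambda>x. f x = 1) c (K \<epsilon>) h" for h
      using val[OF a(5)] a(2) by (intro ext next_action_cong) simp
    then have "S w c \<epsilon> = query_instance.S f c (K \<epsilon>) (poly q (data_size (enc_instance w c \<epsilon>)))"
      by (intro ext) (simp add: S_eq query_instance.S_def[OF query_instance_axioms])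
    then show "error_strategy n f (8 * \<epsilon>) (S w c \<epsilon>)"
      "expected_cost n c (S w c \<epsilon>) \<le> real (opt_worst n f c 0) * total_influence n f / \<epsilon>"
      using S_correct by simp_all
  qed
qed simp

end
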